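(* Let $X$ be a Peano continuum. Then $\mathrm{tf}(H_1(X)) = H_1(X)/\mathrm{tor}(H_1(X))$ is either a free abelian group of finite rank or has cardinality $2^{\aleph_0}$.
   Context: A Peano continuum is a path connected, locally path connected, compact metrizable space. $\mathrm{tor}(A)$ denotes the torsion subgroup of an abelian group $A$, and $\mathrm{tf}(A)=A/\mathrm{tor}(A)$. *)

theory Defs
  imports "HOL-Analysis.Analysis" "HOL-Homology.Homology" "HOL-Algebra.Free_Abelian_Groups"
begin

definition peano_continuum :: "'a topology \<Rightarrow> bool" where
  "peano_continuum X \<longleftrightarrow> path_connected_space X \<and> locally_path_connected_space X
      \<and> compact_space X \<and> metrizable_space X"

definition tor :: "('a, 'b) monoid_scheme \<Rightarrow> 'a set" where
  "tor G = {x \<in> carrier G. \<exists>n::nat. n > 0 \<and> x [^]\<^bsub>G\<^esub> n = \<one>\<^bsub>G\<^esub>}"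

definition tf :: "('a, 'b) monoid_scheme \<Rightarrow> 'a set monoid" where
  "tf G = G Mod (tor G)"

end

(*
If for some radius every small loop of the Peano continuum is torsion in H_1, then subdividing paths
shows that finitely many loops generate H_1 modulo torsion, and a finitely generated torsion-free
abelian group is free.

Otherwise there are non-torsion loops f_0, f_1, ... at one point x that shrink to x. For a binary
sequence a let F(a) be the infinite concatenation of the loops f_n with a_n = 1. Call a and b
equivalent if F(a) - F(b) is torsion in H_1. Since H_1 is abelian, sequences that differ in exactly
one place n are inequivalent: the difference is f_n up to sign. Equivalence is witnessed by a singular
2-chain, that is, by finitely many continuous maps on a triangle. Maps with a given modulus of
continuity form a compact set, so the relation is a Souslin set. A non-meager Souslin set is comeager
in some basic open set, where flipping one coordinate would yield equivalent sequences that differ in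
exactly one place. So the relation is meager, and by Mycielski's argument there are continuum many
pairwise inequivalent sequences.
*)

theory Submission
  imports Defs "HOL-Probability.Discrete_Topology"
begin

subsection \<open>Torsion-free quotients and finitely generated torsion-free groups\<close>

text \<open>Infinite sums have no meaning in homology, so \<open>F(a) - F(b)\<close> cannot be
  computed when a and b differ in infinitely many places. Category avoids this: only differences at
  a single place are ever computed. The obstacle is that being homologous modulo torsion is not
  visibly a closed relation, since the number of triangles, their coefficients and the torsion
  multiplier are unbounded. Those data are countable, but moduli of continuity range over an
  uncountable set of sequences, hence a Souslin scheme instead of a countable union of closed sets.
  The upper bound on the cardinality comes from counting: a compact metric space has at most
  continuum many paths, and every cycle is a finite combination of them. All of this takes place in
  a compact subset of a Banach space homeomorphic to the given space, where paths, distances and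
  uniform continuity are at hand.\<close>

lemma (in comm_group) subgroup_tor: "subgroup (tor G) G"
proof
  fix x y assume "x \<in> tor G" "y \<in> tor G"
  then obtain m n :: nat where x: "x \<in> carrier G" "m > 0" "x [^] m = \<one>"
    and y: "y \<in> carrier G" "n > 0" "y [^] n = \<one>" unfolding tor_def by auto
  have "(x \<otimes> y) [^] (m * n) = (x [^] m) [^] n \<otimes> (y [^] n) [^] m"
    using x(1) y(1) by (simp add: pow_mult_distrib m_comm nat_pow_pow mult.commute)
  also have "\<dots> = \<one>" using x y by simp
  finally show "x \<otimes> y \<in> tor G" unfolding tor_def using x y
    by (auto intro!: exI[of _ "m * n"])
next
  fix x assume "x \<in> tor G"
  then show "inv x \<in> tor G" unfolding tor_def
    by (auto simp: nat_pow_inv)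
qed (auto simp: tor_def intro: exI[of _ 1])

lemma (in comm_group) normal_tor: "tor G \<lhd> G"
  using normal_iff_subgroup subgroup_tor by blast

lemma (in comm_group) comm_group_tf: "comm_group (tf G)"
  unfolding tf_def by (rule abelian_FactGroup[OF subgroup_tor])

lemma (in comm_group) hom_tor_coset: "(\<lambda>a. tor G #> a) \<in> hom G (tf G)"
  unfolding tf_def by (rule normal.r_coset_hom_Mod[OF normal_tor])

lemma (in comm_group) surj_tor_coset: "(\<lambda>a. tor G #> a) ` carrier G = carrier (tf G)"
  unfolding tf_def by (simp add: carrier_FactGroup)

lemma (in comm_group) tor_coset_eq_one_iff:
  assumes "a \<in> carrier G"
  shows "tor G #> a = \<one>\<^bsub>tf G\<^esub> \<longleftrightarrow> a \<in> tor G"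
  unfolding tf_def using assms subgroup_tor
  by (metis coset_join1 coset_join2 one_FactGroup subgroup.subset)

lemma (in comm_group) tf_torsion_free:
  assumes x: "x \<in> carrier (tf G)" and n: "0 < (n::nat)" and e: "x [^]\<^bsub>tf G\<^esub> n = \<one>\<^bsub>tf G\<^esub>"
  shows "x = \<one>\<^bsub>tf G\<^esub>"
proof -
  obtain a where a: "a \<in> carrier G" "x = tor G #> a"
    using x surj_tor_coset by blast
  have "tor G #> (a [^] n) = \<one>\<^bsub>tf G\<^esub>"
    using normal.FactGroup_pow[OF normal_tor a(1)] e a(2) by (simp add: tf_def)
  then have "a [^] n \<in> tor G" using a tor_coset_eq_one_iff by simp
  then obtain m :: nat where "m > 0" "(a [^] n) [^] m = \<one>" unfolding tor_def by auto
  then have "a \<in> tor G" unfolding tor_def using a n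
    by (auto intro!: exI[of _ "n * m"] simp: nat_pow_pow)
  then show ?thesis using a tor_coset_eq_one_iff by simp
qed

text \<open>The first isomorphism theorem in the shape needed to carry \<open>tf\<close> along an
  isomorphism: only the kernel has to be identified.\<close>

lemma kernel_quotient_iso_tf:
  assumes G: "comm_group G" and H: "group H" and h: "h \<in> hom G H"
    and surj: "h ` carrier G = carrier H"
    and ker: "\<And>a. a \<in> carrier G \<Longrightarrow> h a = \<one>\<^bsub>H\<^esub> \<longleftrightarrow> a \<in> tor G"
  shows "tf G \<cong> H"
proof -
  interpret group_hom G H h
    using G H h by (simp add: group_hom_def group_hom_axioms_def comm_group.axioms(2))
  have "kernel G H h = tor G" using ker by (auto simp: kernel_def tor_def)
  then show ?thesis using FactGroup_iso[OF surj] by (simp add: tf_def)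
qed

lemma tor_iso_iff:
  assumes G: "group G" and H: "group H" and f: "f \<in> iso G H" and a: "a \<in> carrier G"
  shows "f a \<in> tor H \<longleftrightarrow> a \<in> tor G"
proof -
  interpret group_hom G H f
    using G H f by (simp add: group_hom_def group_hom_axioms_def iso_def)
  have "f a [^]\<^bsub>H\<^esub> n = \<one>\<^bsub>H\<^esub> \<longleftrightarrow> a [^]\<^bsub>G\<^esub> n = \<one>\<^bsub>G\<^esub>" for n :: nat
    using a f hom_nat_pow[OF a, of n]
    by (metis G.nat_pow_closed G.one_closed bij_betw_imp_inj_on hom_one inj_onD iso_iff)
  then show ?thesis using a by (auto simp: tor_def)
qed

lemma tf_iso_cong:
  assumes G: "comm_group G" and H: "comm_group H" and iso: "G \<cong> H"
  shows "tf G \<cong> tf H"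
proof -
  interpret G: comm_group G by fact
  interpret H: comm_group H by fact
  obtain f where f: "f \<in> iso G H" using iso by (auto simp: is_iso_def)
  have fh: "f \<in> hom G H" "f ` carrier G = carrier H" using f by (auto simp: iso_def bij_betw_def)
  show ?thesis
  proof (rule kernel_quotient_iso_tf[OF G comm_group.axioms(2)[OF H.comm_group_tf], of "(\<lambda>a. tor H #>\<^bsub>H\<^esub> a) \<circ> f"])
    show "(\<lambda>a. tor H #>\<^bsub>H\<^esub> a) \<circ> f \<in> hom G (tf H)"
      using fh H.hom_tor_coset Group.hom_compose by blast
    show "((\<lambda>a. tor H #>\<^bsub>H\<^esub> a) \<circ> f) ` carrier G = carrier (tf H)"
      using fh H.surj_tor_coset by (metis image_comp)
    fix a assume "a \<in> carrier G"
    then show "((\<lambda>a. tor H #>\<^bsub>H\<^esub> a) \<circ> f) a = \<one>\<^bsub>tf H\<^esub> \<longleftrightarrow> a \<in> tor G"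
      using fh H.tor_coset_eq_one_iff tor_iso_iff[OF G.is_group H.is_group f] by (metis comp_apply hom_in_carrier)
  qed
qed

text \<open>One Euclidean step: \<open>sgn a * sgn b * b\<close> is \<open>\<bar>b\<bar>\<close>
  with the sign of \<open>a\<close>, so the absolute value drops by exactly
  \<open>\<bar>b\<bar>\<close>.\<close>

lemma abs_diff_sgn_less:
  fixes a b :: int
  assumes "b \<noteq> 0" "\<bar>b\<bar> \<le> \<bar>a\<bar>"
  shows "\<bar>a - sgn a * sgn b * b\<bar> < \<bar>a\<bar>"
  using assms by (auto simp: sgn_if split: if_splits)

text \<open>Take a generating set of minimal size. Among all nontrivial relations for generating sets of
  this size choose one with the least sum of absolute values of coefficients: a Euclidean step on two
  nonzero coefficients, matched by an elementary change of generators, would decrease it, so the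
  relation kills a multiple of a single generator, which by torsion-freeness is superfluous.\<close>

lemma (in comm_group) finitely_generated_torsion_free_iso:
  assumes tf: "\<And>x n. \<lbrakk>x \<in> carrier G; 0 < (n::nat); x [^] n = \<one>\<rbrakk> \<Longrightarrow> x = \<one>"
    and A: "finite A" "A \<subseteq> carrier G" "generate G A = carrier G"
  shows "\<exists>S :: nat set. finite S \<and> G \<cong> free_Abelian_group S"
proof -
  define P where "P S h \<longleftrightarrow> finite S \<and> h \<in> hom (free_Abelian_group S) G \<and>
      h ` carrier (free_Abelian_group S) = carrier G" for S :: "nat set" and h
  have ex: "\<exists>S h. P S h"
  proof -
    obtain f :: "nat \<Rightarrow> 'a" where f: "bij_betw f {0..<card A} A"
      using A(1) ex_bij_betw_nat_finite by blast
    let ?S = "{0..<card A}"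
    have "f ` ?S \<subseteq> carrier G" using f A by (auto simp: bij_betw_def)
    then obtain h where h: "h \<in> hom (free_Abelian_group ?S) G" "\<And>x. x \<in> ?S \<Longrightarrow> h (frag_of x) = f x"
      using free_Abelian_group_universal by blast
    interpret h: group_hom "free_Abelian_group ?S" G h
      by (simp add: group_hom_def group_hom_axioms_def h)
    have "A \<subseteq> h ` carrier (free_Abelian_group ?S)"
    proof
      fix a assume "a \<in> A"
      then obtain i where "i \<in> ?S" "f i = a" using f by (metis bij_betw_def imageE)
      then have "h (frag_of i) = a" "frag_of i \<in> carrier (free_Abelian_group ?S)" using h by auto
      then show "a \<in> h ` carrier (free_Abelian_group ?S)" by blast
    qed
    then have "generate G A \<subseteq> h ` carrier (free_Abelian_group ?S)"
      using generate_subgroup_incl h.img_is_subgroup by blast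
    then have "P ?S h" unfolding P_def using A(3) h(1) by (auto simp: hom_def)
    then show ?thesis by blast
  qed
  define k where "k = (LEAST k. \<exists>S h. P S h \<and> card S = k)"
  have kex: "\<exists>S h. P S h \<and> card S = k" unfolding k_def
    by (rule LeastI_ex) (use ex in blast)
  have kmin: "k \<le> card S" if "P S h" for S h
    unfolding k_def by (rule Least_le) (use that in blast)
  define Q where "Q S h v \<longleftrightarrow> P S h \<and> card S = k \<and> Poly_Mapping.keys v \<subseteq> S \<and> v \<noteq> 0 \<and> h v = \<one>"
    for S h v
  have noQ: "\<not> Q S h v" for S h v
  proof (induction "nat (\<Sum>i\<in>S. \<bar>poly_mapping.lookup v i\<bar>)" arbitrary: S h v rule: less_induct)
    case less
    show ?case
    proof
      assume Q: "Q S h v"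
      then have S: "finite S" "card S = k" and h: "h \<in> hom (free_Abelian_group S) G"
        and surj: "h ` carrier (free_Abelian_group S) = carrier G"
        and v: "Poly_Mapping.keys v \<subseteq> S" "v \<noteq> 0" "h v = \<one>"
        unfolding Q_def P_def by auto
      interpret h: group_hom "free_Abelian_group S" G h
        by (simp add: group_hom_def group_hom_axioms_def h)
      have add: "h (x + y) = h x \<otimes> h y" if "Poly_Mapping.keys x \<subseteq> S" "Poly_Mapping.keys y \<subseteq> S" for x y
        using h.hom_mult[of x y] that by simp
      have cl: "h x \<in> carrier G" if "Poly_Mapping.keys x \<subseteq> S" for x
        using h.hom_closed[of x] that by simp
      let ?l = poly_mapping.lookup
      obtain i0 where i0: "i0 \<in> S" "?l v i0 \<noteq> 0" using v
        by (metis in_keys_iff keys_eq_empty subsetD ex_in_conv)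
      show False
      proof (cases "\<exists>i\<in>S. i \<noteq> i0 \<and> ?l v i \<noteq> 0")
        case True
        then obtain i j where ij: "i \<in> S" "j \<in> S" "i \<noteq> j" "?l v j \<noteq> 0" "\<bar>?l v j\<bar> \<le> \<bar>?l v i\<bar>"
          by (metis i0 linear)
        define s where "s = sgn (?l v i) * sgn (?l v j)"
        \<comment> \<open>\<open>\<phi>\<close> is an elementary automorphism with inverse
          \<open>\<psi>\<close>. Composing \<open>h\<close> with \<open>\<phi>\<close> adds
          \<open>s\<close> times generator \<open>i\<close> to generator \<open>j\<close>;
          \<open>\<psi> v\<close> is the old relation in the new generators, with coefficient
          \<open>i\<close> reduced by \<open>s\<close> times coefficient \<open>j\<close>.\<close>
        define \<phi> where "\<phi> w = w + frag_cmul (s * ?l w j) (frag_of i)" for w :: "nat \<Rightarrow>\<^sub>0 int"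
        define \<psi> where "\<psi> w = w - frag_cmul (s * ?l w j) (frag_of i)" for w :: "nat \<Rightarrow>\<^sub>0 int"
        have \<phi>k: "Poly_Mapping.keys (\<phi> w) \<subseteq> S" if "Poly_Mapping.keys w \<subseteq> S" for w
          unfolding \<phi>_def using that ij by (auto simp: in_keys_iff lookup_add lookup_single when_def subset_iff split: if_splits)
        have \<psi>k: "Poly_Mapping.keys (\<psi> w) \<subseteq> S" if "Poly_Mapping.keys w \<subseteq> S" for w
          unfolding \<psi>_def using that ij by (auto simp: in_keys_iff lookup_minus lookup_single when_def subset_iff split: if_splits)
        have \<phi>\<psi>: "\<phi> (\<psi> w) = w" for w
          unfolding \<phi>_def \<psi>_def using ij by (intro poly_mapping_eqI) (simp add: lookup_add lookup_minus)
        have "h \<circ> \<phi> \<in> hom (free_Abelian_group S) G"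
        proof (rule homI)
          fix x y assume xy: "x \<in> carrier (free_Abelian_group S)" "y \<in> carrier (free_Abelian_group S)"
          have "\<phi> (x + y) = \<phi> x + \<phi> y" unfolding \<phi>_def
            by (intro poly_mapping_eqI) (simp add: lookup_add algebra_simps)
          then show "(h \<circ> \<phi>) (x \<otimes>\<^bsub>free_Abelian_group S\<^esub> y) = (h \<circ> \<phi>) x \<otimes> (h \<circ> \<phi>) y"
            using add \<phi>k xy by simp
        qed (use \<phi>k h.hom_closed in simp)
        moreover have "(h \<circ> \<phi>) ` carrier (free_Abelian_group S) = carrier G"
        proof -
          have "\<phi> ` carrier (free_Abelian_group S) = carrier (free_Abelian_group S)"
            using \<phi>k \<psi>k \<phi>\<psi> by (auto simp: image_iff) (metis \<phi>\<psi> \<psi>k carrier_free_Abelian_group_iff)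
          then show ?thesis using surj by (metis image_comp)
        qed
        moreover have "\<psi> v \<noteq> 0" using \<phi>\<psi>[of v] v(2) by (auto simp: \<phi>_def)
        ultimately have "Q S (h \<circ> \<phi>) (\<psi> v)"
          unfolding Q_def P_def using S v \<psi>k \<phi>\<psi> by simp
        moreover have "(\<Sum>x\<in>S. \<bar>?l (\<psi> v) x\<bar>) < (\<Sum>x\<in>S. \<bar>?l v x\<bar>)"
        proof (rule sum_strict_mono_ex1[OF S(1)])
          have *: "\<bar>?l (\<psi> v) i\<bar> < \<bar>?l v i\<bar>"
            unfolding \<psi>_def s_def using abs_diff_sgn_less ij by (simp add: lookup_minus)
          moreover have "?l (\<psi> v) x = ?l v x" if "x \<noteq> i" for x
            unfolding \<psi>_def using that by (simp add: lookup_minus)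
          ultimately show "\<forall>x\<in>S. \<bar>?l (\<psi> v) x\<bar> \<le> \<bar>?l v x\<bar>" by (metis order.refl less_imp_le)
          show "\<exists>a\<in>S. \<bar>?l (\<psi> v) a\<bar> < \<bar>?l v a\<bar>" using * ij by blast
        qed
        then have "nat (\<Sum>x\<in>S. \<bar>?l (\<psi> v) x\<bar>) < nat (\<Sum>x\<in>S. \<bar>?l v x\<bar>)"
          by (metis sum_nonneg abs_ge_zero nat_less_eq_zless)
        ultimately show False using less by blast
      next
        case False
        have vk: "v = frag_cmul (?l v i0) (frag_of i0)"
          by (rule poly_mapping_eqI) (use False v(1) in \<open>auto simp: lookup_single when_def in_keys_iff subset_iff\<close>)
        have gi: "h (frag_of i0) \<in> carrier G" using i0 by simp
        have hcm: "h (frag_cmul (int n) (frag_of i0)) = h (frag_of i0) [^] n" for n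
          using h.hom_nat_pow[of "frag_of i0" n] i0 by simp
        have "h (frag_of i0) [^] nat \<bar>?l v i0\<bar> = \<one>"
        proof (cases "?l v i0 \<ge> 0")
          case True then show ?thesis using hcm[of "nat \<bar>?l v i0\<bar>"] vk v(3) by simp
        next
          case False
          then have "frag_cmul (int (nat \<bar>?l v i0\<bar>)) (frag_of i0) = - v"
            by (subst (2) vk) simp
          then show ?thesis using hcm[of "nat \<bar>?l v i0\<bar>"] v h.hom_inv[of v] by simp
        qed
        then have one: "h (frag_of i0) = \<one>" by (rule tf[OF gi, rotated]) (use i0 in auto)
        have hc0: "h (frag_cmul c (frag_of i0)) = \<one>" for c
        proof (cases "c \<ge> 0")
          case True then show ?thesis using hcm[of "nat c"] one by simp
        next
          case False
          have "h (frag_cmul (- c) (frag_of i0)) = \<one>" using hcm[of "nat (- c)"] one False by simp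
          moreover have "Poly_Mapping.keys (frag_cmul (- c) (frag_of i0)) \<subseteq> S"
            using i0 keys_cmul[of "-c" "frag_of i0"] by auto
          ultimately show ?thesis using h.hom_inv[of "frag_cmul (- c) (frag_of i0)"] by simp
        qed
        have "P (S - {i0}) h"
          unfolding P_def
        proof (intro conjI)
          show "finite (S - {i0})" using S by simp
          show "h \<in> hom (free_Abelian_group (S - {i0})) G"
            by (intro homI) (auto simp: subset_Diff_insert add cl)
          show "h ` carrier (free_Abelian_group (S - {i0})) = carrier G"
          proof
            show "h ` carrier (free_Abelian_group (S - {i0})) \<subseteq> carrier G"
              by (auto simp: subset_Diff_insert cl)
            show "carrier G \<subseteq> h ` carrier (free_Abelian_group (S - {i0}))"
            proof
              fix g assume "g \<in> carrier G"
              then obtain w where w: "Poly_Mapping.keys w \<subseteq> S" "g = h w" using surj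
                by (metis carrier_free_Abelian_group_iff imageE)
              let ?c = "frag_cmul (?l w i0) (frag_of i0)"
              have k: "Poly_Mapping.keys (w - ?c) \<subseteq> S - {i0}"
                using w(1) i0 by (auto simp: in_keys_iff subset_iff lookup_minus lookup_single when_def split: if_splits)
              have "Poly_Mapping.keys ?c \<subseteq> S" using i0 keys_cmul[of _ "frag_of i0"] by auto
              then have "h (w - ?c + ?c) = h (w - ?c) \<otimes> h ?c" using k by (intro add) auto
              moreover have "h (w - ?c) \<in> carrier G" using k by (intro cl) auto
              ultimately have "g = h (w - ?c)" using w hc0 by simp
              then show "g \<in> h ` carrier (free_Abelian_group (S - {i0}))" using k by auto
            qed
          qed
        qed
        from kmin[OF this] show False using S i0 by (metis card_Diff1_less not_less)
      qed
    qed
  qed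
  obtain S h where Sh: "P S h" "card S = k" using kex by blast
  then interpret h: group_hom "free_Abelian_group S" G h
    by (simp add: group_hom_def group_hom_axioms_def P_def)
  have "inj_on h (carrier (free_Abelian_group S))"
    unfolding h.inj_on_one_iff using noQ[of S h] Sh by (auto simp: Q_def)
  then have "h \<in> iso (free_Abelian_group S) G"
    using Sh by (auto simp: iso_def bij_betw_def P_def)
  then have "G \<cong> free_Abelian_group S"
    using group.iso_sym[OF group_free_Abelian_group] is_isoI by blast
  then show ?thesis using Sh P_def by blast
qed

subsection \<open>Baire category for Souslin schemes in sequence spaces\<close>

text \<open>The basic open sets of the product topology with discrete factors, named by a point and
  a length. Category is phrased through them, so the alphabet carries no topology of its
  own.\<close>

definition cyl :: "(nat \<Rightarrow> 'c) \<Rightarrow> nat \<Rightarrow> (nat \<Rightarrow> 'c) set" where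
  "cyl x n = {y. \<forall>i<n. y i = x i}"

definition nowhere_dense :: "(nat \<Rightarrow> 'c) set \<Rightarrow> bool" where
  "nowhere_dense N \<longleftrightarrow> (\<forall>x n. \<exists>y\<in>cyl x n. \<exists>m\<ge>n. cyl y m \<inter> N = {})"

definition meager :: "(nat \<Rightarrow> 'c) set \<Rightarrow> bool" where
  "meager M \<longleftrightarrow> (\<exists>N :: nat \<Rightarrow> _. (\<forall>k. nowhere_dense (N k)) \<and> M \<subseteq> (\<Union>k. N k))"

lemma cyl_refl [simp]: "x \<in> cyl x n"
  by (simp add: cyl_def)

lemma cyl_subset: "y \<in> cyl x n \<Longrightarrow> n \<le> m \<Longrightarrow> cyl y m \<subseteq> cyl x n"
  by (auto simp: cyl_def)

lemma nowhere_dense_Un: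
  assumes "nowhere_dense M" "nowhere_dense N"
  shows "nowhere_dense (M \<union> N)"
  unfolding nowhere_dense_def
proof (intro allI)
  fix x n
  obtain y m where y: "y \<in> cyl x n" "n \<le> m" "cyl y m \<inter> M = {}"
    using assms(1) unfolding nowhere_dense_def by meson
  obtain z k where z: "z \<in> cyl y m" "m \<le> k" "cyl z k \<inter> N = {}"
    using assms(2) unfolding nowhere_dense_def by meson
  have "z \<in> cyl x n" "n \<le> k" "cyl z k \<inter> (M \<union> N) = {}"
    using y z cyl_subset[OF y(1,2)] cyl_subset[OF z(1,2)] by auto
  then show "\<exists>y\<in>cyl x n. \<exists>m\<ge>n. cyl y m \<inter> (M \<union> N) = {}" by blast
qed

lemma nowhere_dense_empty: "nowhere_dense {}"
  unfolding nowhere_dense_def by (meson cyl_refl inf_bot_right order_refl)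

lemma nowhere_dense_UN_atMost:
  assumes "\<And>k. nowhere_dense (N k)"
  shows "nowhere_dense (\<Union>j\<le>(k::nat). N j)"
proof (induction k)
  case (Suc k)
  have "(\<Union>j\<le>Suc k. N j) = (\<Union>j\<le>k. N j) \<union> N (Suc k)" by (auto simp: le_Suc_eq)
  then show ?case using Suc assms nowhere_dense_Un by metis
qed (use assms in simp)

lemma meager_subset: "meager N \<Longrightarrow> M \<subseteq> N \<Longrightarrow> meager M"
  unfolding meager_def by blast

lemma nowhere_dense_imp_meager: "nowhere_dense M \<Longrightarrow> meager M"
  unfolding meager_def by (intro exI[of _ "\<lambda>_. M"]) auto

lemma meager_empty: "meager {}"
  by (rule nowhere_dense_imp_meager[OF nowhere_dense_empty])

lemma meager_UN:
  assumes "\<And>i::'i::countable. meager (F i)"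
  shows "meager (\<Union>i. F i)"
proof -
  obtain N where N: "\<And>i (k::nat). nowhere_dense (N i k)" "\<And>i. F i \<subseteq> (\<Union>k. N i k)"
    using assms unfolding meager_def by metis
  define N' where "N' j = (case prod_decode j of (a, k) \<Rightarrow> N (from_nat a) k)" for j
  have "nowhere_dense (N' j)" for j unfolding N'_def using N by (auto split: prod.split)
  moreover have "(\<Union>i. F i) \<subseteq> (\<Union>j. N' j)"
  proof clarify
    fix x i assume "x \<in> F i"
    then obtain k where "x \<in> N i k" using N(2) by blast
    then have "x \<in> N' (prod_encode (to_nat i, k))" by (simp add: N'_def)
    then show "x \<in> (\<Union>j. N' j)" by blast
  qed
  ultimately show ?thesis unfolding meager_def by blast
qed

lemma meager_Un: "meager M \<Longrightarrow> meager N \<Longrightarrow> meager (M \<union> N)"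
  by (rule meager_subset[OF meager_UN[of "\<lambda>b. if b then M else N"]]) auto

text \<open>Prefixes are treated one after another, each time lengthening the common word
  \<open>w\<close>. Lengthening does no harm to prefixes already treated, because avoidance of
  \<open>U\<close> was secured by the shorter word.\<close>

lemma finite_simultaneous_extension:
  assumes U: "nowhere_dense U" and P: "finite P"
  shows "\<exists>m>n. \<exists>w. \<forall>x\<in>P. \<forall>z\<in>cyl x n. (\<forall>i\<in>{n..<m}. z i = w i) \<longrightarrow> z \<notin> U"
  using P
proof (induction P)
  case empty
  then show ?case by auto
next
  case (insert x P)
  then obtain m w where m: "m > n"
    and w: "\<And>x z. x \<in> P \<Longrightarrow> z \<in> cyl x n \<Longrightarrow> (\<forall>i\<in>{n..<m}. z i = w i) \<Longrightarrow> z \<notin> U" by blast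
  \<comment> \<open>Start from the new prefix followed by the word found so far; only entries from
    \<open>m\<close> on are then still free.\<close>
  define y where "y i = (if i < n then x i else w i)" for i
  obtain y' m' where y': "y' \<in> cyl y m" "m \<le> m'" "cyl y' m' \<inter> U = {}"
    using U unfolding nowhere_dense_def by meson
  have "z \<notin> U" if z: "v \<in> insert x P" "z \<in> cyl v n" "\<forall>i\<in>{n..<m'}. z i = y' i" for v z
  proof (cases "v \<in> P")
    case True
    moreover have "z i = w i" if "i \<in> {n..<m}" for i
      using that z y' by (auto simp: cyl_def y_def)
    ultimately show ?thesis using w z by blast
  next
    case False
    then have "z i = y' i" if "i < m'" for i
      using that z y' m by (cases "i < n") (auto simp: cyl_def y_def)
    then have "z \<in> cyl y' m'" by (auto simp: cyl_def)
    then show ?thesis using y' by blast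
  qed
  moreover have "m' > n" using m y' by simp
  ultimately show ?case by blast
qed

text \<open>A finite alphabet has finitely many prefixes of length \<open>n\<close>, so one word
  serves them all. Avoidance then depends on the block alone and not on what precedes it.\<close>

lemma nowhere_dense_avoiding_block:
  fixes U :: "(nat \<Rightarrow> 'c::finite) set"
  assumes U: "nowhere_dense U"
  shows "\<exists>m>n. \<exists>w. \<forall>z. (\<forall>i\<in>{n..<m}. z i = w i) \<longrightarrow> z \<notin> U"
proof -
  let ?P = "PiE {..<n} (\<lambda>_. UNIV :: 'c set)"
  obtain m w where m: "m > n" "\<And>x z. x \<in> ?P \<Longrightarrow> z \<in> cyl x n \<Longrightarrow> (\<forall>i\<in>{n..<m}. z i = w i) \<Longrightarrow> z \<notin> U"
    using finite_simultaneous_extension[OF U, of ?P n] finite_PiE[of "{..<n}" "\<lambda>_. UNIV :: 'c set"]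
    by (metis finite_lessThan finite)
  have "z \<notin> U" if "\<forall>i\<in>{n..<m}. z i = w i" for z
    by (rule m(2)[of "restrict z {..<n}"]) (use that in \<open>auto simp: cyl_def\<close>)
  then show ?thesis using m by blast
qed

text \<open>The combinatorial description of meager sets: a sequence that matches \<open>w\<close>
  on infinitely many blocks avoids every \<open>N j\<close>. It yields both the Baire theorem and
  the perfect family of inequivalent sequences.\<close>

lemma nowhere_dense_sequence_avoiding_blocks:
  fixes N :: "nat \<Rightarrow> (nat \<Rightarrow> 'c::finite) set"
  assumes N: "\<And>k. nowhere_dense (N k)"
  obtains I :: "nat \<Rightarrow> nat" and w where "strict_mono I"
    "\<And>k j z. j \<le> k \<Longrightarrow> (\<And>i. i \<in> {I k..<I (Suc k)} \<Longrightarrow> z i = w i) \<Longrightarrow> z \<notin> N j"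
proof -
  have "\<forall>n k. \<exists>m>n. \<exists>w. \<forall>z. (\<forall>i\<in>{n..<m}. z i = w i) \<longrightarrow> z \<notin> (\<Union>j\<le>k. N j)"
    using nowhere_dense_avoiding_block nowhere_dense_UN_atMost[of N, OF N] by blast
  then obtain m v where m: "\<And>n k. m n k > n"
    and v: "\<And>n k z. (\<forall>i\<in>{n..<m n k}. z i = v n k i) \<Longrightarrow> z \<notin> (\<Union>j\<le>k. N j)"
    by metis
  define I where "I = rec_nat 0 (\<lambda>k n. m n k)"
  have IS: "I (Suc k) = m (I k) k" for k by (simp add: I_def)
  have mono: "strict_mono I" by (rule strict_monoI_Suc) (use IS m in simp)
  have uniq: "k = l" if "i \<in> {I k..<I (Suc k)}" "i \<in> {I l..<I (Suc l)}" for i k l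
  proof (rule ccontr)
    assume "k \<noteq> l"
    then have "Suc k \<le> l \<or> Suc l \<le> k" by linarith
    then have "I (Suc k) \<le> I l \<or> I (Suc l) \<le> I k" using mono by (meson strict_mono_less_eq)
    then show False using that by auto
  qed
  define w where "w i = (let k = (SOME k. i \<in> {I k..<I (Suc k)}) in v (I k) k i)" for i
  have "w i = v (I k) k i" if "i \<in> {I k..<I (Suc k)}" for i k
  proof -
    have "(SOME k. i \<in> {I k..<I (Suc k)}) = k"
      by (rule some_equality[of "\<lambda>k. i \<in> {I k..<I (Suc k)}", OF that]) (use uniq that in blast)
    then show ?thesis unfolding w_def by simp
  qed
  then have "z \<notin> N j" if "j \<le> k" "\<And>i. i \<in> {I k..<I (Suc k)} \<Longrightarrow> z i = w i" for k j z
    using v[of "I k" k z] that IS by auto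
  then show ?thesis using that[OF mono] by blast
qed

text \<open>The Baire category theorem: keep the first \<open>n\<close> entries of \<open>x\<close>
  and copy \<open>w\<close> afterwards.\<close>

lemma cyl_not_meager:
  fixes M :: "(nat \<Rightarrow> 'c::finite) set"
  assumes "meager M"
  shows "\<exists>z. z \<in> cyl x n - M"
proof -
  obtain N where N: "\<And>k::nat. nowhere_dense (N k)" "M \<subseteq> (\<Union>k. N k)"
    using assms unfolding meager_def by blast
  obtain I :: "nat \<Rightarrow> nat" and w where I: "strict_mono I"
    and w: "\<And>k j z. j \<le> k \<Longrightarrow> (\<And>i. i \<in> {I k..<I (Suc k)} \<Longrightarrow> z i = w i) \<Longrightarrow> z \<notin> N j"
    using nowhere_dense_sequence_avoiding_blocks[of N] N(1) by blast
  define z where "z i = (if i < n then x i else w i)" for i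
  \<comment> \<open>Block \<open>max j n\<close> has index at least \<open>j\<close>, and it starts
    at position at least \<open>n\<close> because a strictly monotone \<open>I\<close> satisfies
    \<open>k \<le> I k\<close>.\<close>
  have "z \<notin> N j" for j
  proof (rule w[of j "max j n"])
    fix i assume "i \<in> {I (max j n)..<I (Suc (max j n))}"
    then have "n \<le> i" using strict_mono_imp_increasing[OF I, of "max j n"] by auto
    then show "z i = w i" by (simp add: z_def)
  qed simp
  then show ?thesis using N(2) by (intro exI[of _ z]) (auto simp: z_def cyl_def)
qed

text \<open>Banach's category argument: on the union of all cylinders in which \<open>B\<close> is
  meager, \<open>B\<close> is meager. If that union were dense in \<open>cyl x n\<close>, the rest
  of \<open>cyl x n\<close> would be nowhere dense and \<open>B\<close> meager there.\<close>

lemma non_meager_imp_everywhere_non_meager_on_cyl: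
  fixes B :: "(nat \<Rightarrow> 'c::countable) set"
  assumes "\<not> meager (B \<inter> cyl x n)"
  shows "\<exists>y\<in>cyl x n. \<exists>m\<ge>n. \<forall>z\<in>cyl y m. \<forall>k\<ge>m. \<not> meager (B \<inter> cyl z k)"
proof (rule ccontr)
  assume neg: "\<not> ?thesis"
  \<comment> \<open>Cylinders are indexed by words, of which there are countably many, so that
    \<open>meager_UN\<close> applies.\<close>
  define L where "L s = {z. \<forall>i<length s. z i = s ! i}" for s :: "'c list"
  have Lc: "cyl z k = L (map z [0..<k])" for z :: "nat \<Rightarrow> 'c" and k by (simp add: L_def cyl_def)
  define U where "U s = (if meager (B \<inter> L s) then L s else {})" for s
  have "meager (\<Union>s. B \<inter> U s)"
    by (rule meager_UN) (auto simp: U_def meager_empty)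
  moreover have "nowhere_dense (cyl x n - (\<Union>s. U s))"
    unfolding nowhere_dense_def
  proof (intro allI)
    fix y m
    show "\<exists>z\<in>cyl y m. \<exists>k\<ge>m. cyl z k \<inter> (cyl x n - (\<Union>s. U s)) = {}"
    proof (cases "cyl y m \<inter> cyl x n = {}")
      case True
      then show ?thesis by (intro bexI[of _ y] exI[of _ m]) auto
    next
      case False
      then obtain y' where y': "y' \<in> cyl y m" "y' \<in> cyl x n" by blast
      obtain z k where z: "z \<in> cyl y' (max m n)" "k \<ge> max m n" "meager (B \<inter> cyl z k)"
        using neg y' by (meson max.cobounded2 cyl_subset subsetD cyl_def order_refl)
      have "cyl z k \<subseteq> U (map z [0..<k])" using z(3) by (simp add: U_def Lc)
      moreover have "z \<in> cyl y m" using z(1) y' by (auto simp: cyl_def)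
      ultimately show ?thesis using z(2) by (intro bexI[of _ z] exI[of _ k]) auto
    qed
  qed
  ultimately have "meager ((\<Union>s. B \<inter> U s) \<union> (cyl x n - (\<Union>s. U s)))"
    using meager_Un nowhere_dense_imp_meager by blast
  then have "meager (B \<inter> cyl x n)" by (rule meager_subset) auto
  then show False using assms by simp
qed

text \<open>Let \<open>V s\<close> be the open set near whose points \<open>A s\<close> is everywhere non-meager. Each
  \<open>V s - (\<Union>k. V (s @ [k]))\<close> is nowhere dense, and a point of \<open>V []\<close> outside all of these
  follows a branch along which it stays in the closure of the scheme.\<close>

lemma souslin_non_meager_imp_comeager_on_cyl:
  fixes A :: "nat list \<Rightarrow> (nat \<Rightarrow> 'c::countable) set"
  assumes A: "\<And>s. A s \<subseteq> (\<Union>k. A (s @ [k]))"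
    and lim: "\<And>\<omega> z. (\<And>n. A (map \<omega> [0..<n]) \<inter> cyl z n \<noteq> {}) \<Longrightarrow> z \<in> A []"
    and nm: "\<not> meager (A [])"
  shows "\<exists>x n M. meager M \<and> cyl x n - M \<subseteq> A []"
proof -
  define V where "V s = {x. \<exists>n. \<forall>z\<in>cyl x n. \<forall>k\<ge>n. \<not> meager (A s \<inter> cyl z k)}" for s
  define D where "D s = V s - (\<Union>k. V (s @ [k]))" for s
  have VI: "cyl y m \<subseteq> V s" if "\<forall>z\<in>cyl y m. \<forall>k\<ge>m. \<not> meager (A s \<inter> cyl z k)" for y m s
  proof
    fix v assume "v \<in> cyl y m"
    then have "cyl v m \<subseteq> cyl y m" by (rule cyl_subset) simp
    then show "v \<in> V s" unfolding V_def using that by blast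
  qed
  have "nowhere_dense (D s)" for s
    unfolding nowhere_dense_def
  proof (intro allI)
    fix x n
    show "\<exists>y\<in>cyl x n. \<exists>m\<ge>n. cyl y m \<inter> D s = {}"
    proof (cases "cyl x n \<inter> V s = {}")
      case True
      then show ?thesis by (intro bexI[of _ x] exI[of _ n]) (auto simp: D_def)
    next
      case False
      then obtain y m where y: "y \<in> cyl x n" "\<forall>z\<in>cyl y m. \<forall>k\<ge>m. \<not> meager (A s \<inter> cyl z k)"
        by (auto simp: V_def)
      let ?m = "max m n"
      have "\<not> meager (A s \<inter> cyl y ?m)" using y by simp
      moreover have "A s \<inter> cyl y ?m \<subseteq> (\<Union>k. A (s @ [k]) \<inter> cyl y ?m)" using A by blast
      ultimately have "\<not> meager (\<Union>k. A (s @ [k]) \<inter> cyl y ?m)" using meager_subset by blast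
      then obtain k where "\<not> meager (A (s @ [k]) \<inter> cyl y ?m)"
        using meager_UN[of "\<lambda>k. A (s @ [k]) \<inter> cyl y ?m"] by blast
      then obtain z l where z: "z \<in> cyl y ?m" "l \<ge> ?m"
          "\<forall>u\<in>cyl z l. \<forall>j\<ge>l. \<not> meager (A (s @ [k]) \<inter> cyl u j)"
        using non_meager_imp_everywhere_non_meager_on_cyl by blast
      have "cyl z l \<subseteq> V (s @ [k])" using VI z(3) by blast
      then have "cyl z l \<inter> D s = {}" unfolding D_def by blast
      moreover have "z \<in> cyl x n" using z(1) y(1) by (auto simp: cyl_def)
      ultimately show ?thesis using z(2) by (intro bexI[of _ z] exI[of _ l]) auto
    qed
  qed
  then have D: "meager (\<Union>s. D s)" by (intro meager_UN nowhere_dense_imp_meager)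
  have "A [] \<inter> cyl undefined 0 = A []" by (auto simp: cyl_def)
  then obtain y m where "\<forall>z\<in>cyl y m. \<forall>k\<ge>m. \<not> meager (A [] \<inter> cyl z k)"
    using non_meager_imp_everywhere_non_meager_on_cyl[of "A []" undefined 0] nm by auto
  then have V0: "cyl y m \<subseteq> V []" by (rule VI)
  have "z \<in> A []" if z: "z \<in> cyl y m" "z \<notin> (\<Union>s. D s)" for z
  proof -
    have step: "\<exists>k. z \<in> V (s @ [k])" if "z \<in> V s" for s
      using that z(2) unfolding D_def by blast
    \<comment> \<open>Outside all \<open>D s\<close>, membership of \<open>z\<close> in
      \<open>V s\<close> passes on to a child of \<open>s\<close>. Choosing a child each time gives
      a branch, with \<open>S\<close> as its initial segments, to which \<open>lim\<close>
      applies.\<close>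
    define nx where "nx s = (SOME k. z \<in> V (s @ [k]))" for s
    have nx: "z \<in> V (s @ [nx s])" if "z \<in> V s" for s
      unfolding nx_def using step[OF that] by (rule someI_ex)
    define S where "S = rec_nat [] (\<lambda>_ s. s @ [nx s])"
    have S: "S 0 = []" "S (Suc n) = S n @ [nx (S n)]" for n by (simp_all add: S_def)
    have Sm: "S n = map (nx \<circ> S) [0..<n]" for n by (induction n) (simp_all add: S)
    have SV: "z \<in> V (S n)" for n by (induction n) (use V0 z(1) nx S in auto)
    show ?thesis
    proof (rule lim)
      fix n
      from SV[of n] obtain m where "\<forall>u\<in>cyl z m. \<forall>k\<ge>m. \<not> meager (A (S n) \<inter> cyl u k)"
        by (auto simp: V_def)
      then have "\<not> meager (A (S n) \<inter> cyl z (max m n))" by simp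
      then have "A (S n) \<inter> cyl z (max m n) \<noteq> {}" using meager_empty by metis
      then show "A (map (nx \<circ> S) [0..<n]) \<inter> cyl z n \<noteq> {}" using Sm[of n] by (auto simp: cyl_def)
    qed
  qed
  then show ?thesis using D by (intro exI[of _ y] exI[of _ m] exI[of _ "\<Union>s. D s"]) auto
qed

text \<open>Changing one coordinate by an involution permutes the cylinders of each length, so it
  preserves category.\<close>

lemma nowhere_dense_vimage_update:
  fixes t :: "'c \<Rightarrow> 'c"
  assumes N: "nowhere_dense N" and t: "\<And>a. t (t a) = a"
  shows "nowhere_dense {z. z(n := t (z n)) \<in> N}"
  unfolding nowhere_dense_def
proof (intro allI)
  fix x :: "nat \<Rightarrow> 'c" and k
  define \<tau> where "\<tau> z = z(n := t (z n))" for z :: "nat \<Rightarrow> 'c"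
  have \<tau>c: "\<tau> z \<in> cyl (\<tau> y) m \<longleftrightarrow> z \<in> cyl y m" for z y m
  proof -
    have "t a = t b \<longleftrightarrow> a = b" for a b by (metis t)
    then show ?thesis by (simp add: \<tau>_def cyl_def) (metis)
  qed
  have \<tau>\<tau>: "\<tau> (\<tau> z) = z" for z by (auto simp: \<tau>_def t)
  obtain y m where y: "y \<in> cyl (\<tau> x) k" "m \<ge> k" "cyl y m \<inter> N = {}"
    using N unfolding nowhere_dense_def by meson
  have "\<tau> y \<in> cyl x k" using y(1) \<tau>c[of "\<tau> y" x] \<tau>\<tau> by simp
  moreover have "cyl (\<tau> y) m \<inter> {z. \<tau> z \<in> N} = {}"
    using y(3) \<tau>c[of _ "\<tau> y"] \<tau>\<tau> by fastforce
  ultimately show "\<exists>y\<in>cyl x k. \<exists>m\<ge>k. cyl y m \<inter> {z. z(n := t (z n)) \<in> N} = {}"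
    using y(2) unfolding \<tau>_def by blast
qed

lemma meager_vimage_update:
  assumes "meager M" "\<And>a. t (t a) = a"
  shows "meager {z. z(n := t (z n)) \<in> M}"
proof -
  obtain N where N: "\<And>k::nat. nowhere_dense (N k)" "M \<subseteq> (\<Union>k. N k)"
    using assms(1) unfolding meager_def by blast
  then show ?thesis unfolding meager_def
    by (intro exI[of _ "\<lambda>k. {z. z(n := t (z n)) \<in> N k}"])
      (use nowhere_dense_vimage_update[of _ t n] assms(2) in blast)
qed

text \<open>A pair of sequences is read as one sequence over \<open>bool \<times> bool\<close>, so
  that the results on category in a single sequence space apply to the relation.\<close>

lemma souslin_equivalence_meager:
  fixes E :: "(nat \<Rightarrow> bool) \<Rightarrow> (nat \<Rightarrow> bool) \<Rightarrow> bool" and A :: "nat list \<Rightarrow> (nat \<Rightarrow> bool \<times> bool) set"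
  assumes sym: "\<And>a b. E a b \<Longrightarrow> E b a" and trans: "\<And>a b c. E a b \<Longrightarrow> E b c \<Longrightarrow> E a c"
    and flip: "\<And>a n. \<not> E a (a(n := \<not> a n))"
    and A: "\<And>s. A s \<subseteq> (\<Union>k. A (s @ [k]))"
    and lim: "\<And>\<omega> z. (\<And>n. A (map \<omega> [0..<n]) \<inter> cyl z n \<noteq> {}) \<Longrightarrow> z \<in> A []"
    and AE: "A [] = {z. E (fst \<circ> z) (snd \<circ> z)}"
  shows "meager (A [])"
proof (rule ccontr)
  assume "\<not> meager (A [])"
  then obtain x n M where M: "meager M" "cyl x n - M \<subseteq> A []"
    using souslin_non_meager_imp_comeager_on_cyl[of A] A lim by blast
  define t :: "bool \<times> bool \<Rightarrow> bool \<times> bool" where "t p = (\<not> fst p, snd p)" for p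
  have "meager (M \<union> {z. z(n := t (z n)) \<in> M})"
    by (intro meager_Un M meager_vimage_update) (auto simp: t_def)
  \<comment> \<open>Position \<open>n\<close> is the first one not fixed by the cylinder, so the
    flip stays inside it. Only the first component is flipped: both pairs share their second
    component, and transitivity relates the two first ones.\<close>
  then obtain z where z: "z \<in> cyl x n" "z \<notin> M" "z(n := t (z n)) \<notin> M"
    using cyl_not_meager by fastforce
  have "z(n := t (z n)) \<in> cyl x n" using z(1) by (auto simp: cyl_def)
  then have "z \<in> A []" "z(n := t (z n)) \<in> A []" using M z by auto
  then have "E (fst \<circ> z) (snd \<circ> z)" "E ((fst \<circ> z)(n := \<not> (fst \<circ> z) n)) (snd \<circ> z)"
    using AE by (auto simp: t_def fun_upd_comp fun_upd_idem)
  then show False using sym trans flip by blast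
qed

text \<open>Copy into block \<open>k\<close> of \<open>g x\<close> the first
  or second component of the block avoiding the first \<open>k\<close> nowhere dense sets, according to whether the
  \<open>k\<close>-th finite sequence is a prefix of \<open>x\<close>.\<close>

lemma meager_relation_imp_inequivalent_family:
  fixes E :: "(nat \<Rightarrow> bool) \<Rightarrow> (nat \<Rightarrow> bool) \<Rightarrow> bool"
  assumes "meager {z. E (fst \<circ> z) (snd \<circ> z)}"
  shows "\<exists>g :: (nat \<Rightarrow> bool) \<Rightarrow> nat \<Rightarrow> bool. \<forall>x y. x \<noteq> y \<longrightarrow> \<not> E (g x) (g y)"
proof -
  obtain N where N: "\<And>k::nat. nowhere_dense (N k)" "{z. E (fst \<circ> z) (snd \<circ> z)} \<subseteq> (\<Union>k. N k)"
    using assms unfolding meager_def by blast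
  obtain I :: "nat \<Rightarrow> nat" and w where I: "strict_mono I"
    and w: "\<And>k j z. j \<le> k \<Longrightarrow> (\<And>i. i \<in> {I k..<I (Suc k)} \<Longrightarrow> z i = w i) \<Longrightarrow> z \<notin> N j"
    using nowhere_dense_sequence_avoiding_blocks[of N] N(1) by blast
  define pre where "pre k x \<longleftrightarrow> map x [0..<length (from_nat k :: bool list)] = from_nat k"
    for k and x :: "nat \<Rightarrow> bool"
  define g where "g x i = (if \<exists>k. i \<in> {I k..<I (Suc k)} \<and> pre k x then fst (w i) else snd (w i))" for x i
  have uniq: "k = l" if "i \<in> {I k..<I (Suc k)}" "i \<in> {I l..<I (Suc l)}" for i k l
  proof (rule ccontr)
    assume "k \<noteq> l"
    then have "Suc k \<le> l \<or> Suc l \<le> k" by linarith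
    then have "I (Suc k) \<le> I l \<or> I (Suc l) \<le> I k" using I by (meson strict_mono_less_eq)
    then show False using that by auto
  qed
  have g: "g x i = (if pre k x then fst (w i) else snd (w i))" if "i \<in> {I k..<I (Suc k)}" for x i k
    unfolding g_def using that uniq by metis
  have "\<not> E (g x) (g y)" if xy: "x \<noteq> y" for x y
  proof
    assume E: "E (g x) (g y)"
    define z where "z i = (g x i, g y i)" for i
    have "fst \<circ> z = g x" "snd \<circ> z = g y" by (auto simp: z_def)
    then have "z \<in> {z. E (fst \<circ> z) (snd \<circ> z)}" using E by simp
    then obtain j where j: "z \<in> N j" using N(2) by blast
    obtain a where a: "x a \<noteq> y a" using xy by auto
    \<comment> \<open>Every prefix of \<open>x\<close> longer than \<open>a\<close> fails to be a
      prefix of \<open>y\<close>. There are infinitely many, so one has a code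
      \<open>k \<ge> j\<close>; in block \<open>k\<close> the pair \<open>z\<close> then copies
      \<open>w\<close> in both components.\<close>
    define e where "e l = to_nat (map x [0..<l])" for l
    have "inj e" unfolding e_def by (intro injI) (metis diff_zero from_nat_to_nat length_map length_upt)
    then have "infinite (e ` {a<..})" by (metis finite_imageD infinite_Ioi inj_on_subset subset_UNIV)
    then obtain k where k: "k \<in> e ` {a<..}" "k \<ge> j"
      by (meson finite_nat_set_iff_bounded_le linear)
    then obtain l where l: "l > a" "k = to_nat (map x [0..<l])" by (auto simp: e_def)
    have px: "pre k x" "\<not> pre k y"
      using l a by (auto simp: pre_def)
    have "z \<notin> N j"
      by (rule w[OF k(2)]) (use g px in \<open>auto simp: z_def\<close>)
    then show False using j by simp
  qed
  then show ?thesis by blast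
qed

subsection \<open>Singular 1-chains of paths\<close>

text \<open>The standard 2-simplex in its barycentric coordinates 1 and 2. The plane model supplies
  the metric in which moduli of continuity are measured.\<close>

definition tri :: "(real \<times> real) set" where
  "tri = {(u, v). 0 \<le> u \<and> 0 \<le> v \<and> u + v \<le> 1}"

definition point_simplex :: "'a \<Rightarrow> (nat \<Rightarrow> real) \<Rightarrow> 'a" where
  "point_simplex a = restrict (\<lambda>_. a) (standard_simplex 0)"

text \<open>The time parameter is barycentric coordinate 1, so the path runs from vertex 0 to vertex
  1. The restriction is there because singular simplices are extensional.\<close>

definition path_simplex :: "(real \<Rightarrow> 'a) \<Rightarrow> (nat \<Rightarrow> real) \<Rightarrow> 'a" where
  "path_simplex p = restrict (\<lambda>x. p (x 1)) (standard_simplex 1)"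

definition tri_simplex :: "(real \<times> real \<Rightarrow> 'a) \<Rightarrow> (nat \<Rightarrow> real) \<Rightarrow> 'a" where
  "tri_simplex \<tau> = restrict (\<lambda>x. \<tau> (x 1, x 2)) (standard_simplex 2)"

abbreviation path_chain :: "(real \<Rightarrow> 'a) \<Rightarrow> 'a chain" where
  "path_chain p \<equiv> frag_of (path_simplex p)"

lemma standard_simplex_1_iff:
  "x \<in> standard_simplex 1 \<longleftrightarrow> 0 \<le> x 1 \<and> x 1 \<le> 1 \<and> x 0 = 1 - x 1 \<and> (\<forall>i>1. x i = 0)"
proof -
  have *: "(\<forall>i::nat. P i) \<longleftrightarrow> P 0 \<and> P 1 \<and> (\<forall>i>1. P i)" for P
    by (metis One_nat_def less_one linorder_neqE_nat)
  have "(\<Sum>i\<le>1. x i) = x 0 + x 1" by simp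
  then show ?thesis unfolding standard_simplex_def mem_Collect_eq *[of "\<lambda>i. 0 \<le> x i \<and> x i \<le> 1"]
    by auto
qed

lemma standard_simplex_2_iff:
  "x \<in> standard_simplex 2 \<longleftrightarrow> (x 1, x 2) \<in> tri \<and> x 0 = 1 - x 1 - x 2 \<and> (\<forall>i>2. x i = 0)"
proof -
  have *: "(\<forall>i::nat. P i) \<longleftrightarrow> P 0 \<and> P 1 \<and> P 2 \<and> (\<forall>i>2. P i)" for P
    by (metis One_nat_def Suc_1 less_2_cases linorder_neqE_nat)
  have "(\<Sum>i\<le>2. x i) = x 0 + x 1 + x 2" by (simp add: numeral_2_eq_2)
  then show ?thesis unfolding standard_simplex_def mem_Collect_eq tri_def *[of "\<lambda>i. 0 \<le> x i \<and> x i \<le> 1"]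
    by auto
qed

lemma singular_simplex_top_of_set:
  "singular_simplex n (top_of_set S) f \<longleftrightarrow>
     continuous_on (standard_simplex n) f \<and> f ` standard_simplex n \<subseteq> S \<and> f \<in> extensional (standard_simplex n)"
  unfolding singular_simplex_def
  by (auto simp: euclidean_product_topology continuous_map_in_subtopology image_subset_iff Pi_iff)

definition edge_point :: "real \<Rightarrow> nat \<Rightarrow> real" where
  "edge_point t i = (if i = 0 then 1 - t else if i = 1 then t else 0)"

definition tri_point :: "real \<times> real \<Rightarrow> nat \<Rightarrow> real" where
  "tri_point x i = (if i = 0 then 1 - fst x - snd x else if i = 1 then fst x else if i = 2 then snd x else 0)"

lemma edge_point_in: "t \<in> {0..1} \<Longrightarrow> edge_point t \<in> standard_simplex 1"
  unfolding standard_simplex_1_iff by (simp add: edge_point_def)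

lemma tri_point_in: "x \<in> tri \<Longrightarrow> tri_point x \<in> standard_simplex 2"
  by (simp add: standard_simplex_2_iff tri_point_def)

lemma edge_point_eq: "x \<in> standard_simplex 1 \<Longrightarrow> edge_point (x 1) = x"
  unfolding standard_simplex_1_iff edge_point_def by auto

lemma tri_point_eq:
  assumes "x \<in> standard_simplex 2"
  shows "tri_point (x 1, x 2) = x"
proof
  fix i :: nat
  have "i = 0 \<or> i = 1 \<or> i = 2 \<or> i > 2" by linarith
  then show "tri_point (x 1, x 2) i = x i"
    using assms unfolding standard_simplex_2_iff tri_point_def by auto
qed

lemma continuous_on_edge_point: "continuous_on A edge_point"
proof (rule continuous_on_coordinatewise_then_product)
  show "continuous_on A (\<lambda>x. edge_point x i)" for i
    unfolding edge_point_def by (cases "i = 0"; cases "i = 1") (auto intro!: continuous_intros)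
qed

lemma continuous_on_tri_point: "continuous_on A tri_point"
proof (rule continuous_on_coordinatewise_then_product)
  show "continuous_on A (\<lambda>x. tri_point x i)" for i
    unfolding tri_point_def by (cases "i = 0"; cases "i = 1"; cases "i = 2") (auto intro!: continuous_intros)
qed

lemma singular_simplex_path_simplex:
  assumes "path p" "path_image p \<subseteq> S"
  shows "singular_simplex 1 (top_of_set S) (path_simplex p)"
proof -
  have im: "(\<lambda>x. x 1) ` standard_simplex 1 \<subseteq> {0..1::real}" unfolding image_subset_iff Ball_def standard_simplex_1_iff by simp
  have "continuous_on (standard_simplex 1) (\<lambda>x. p (x 1))"
    using assms(1) unfolding path_def
    by (rule continuous_on_compose2[OF _ _ im]) (rule continuous_on_subset[OF continuous_on_product_coordinates subset_UNIV])
  moreover have "p (x 1) \<in> S" if "x \<in> standard_simplex 1" for x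
    using assms(2) im that unfolding path_image_def by blast
  ultimately show ?thesis
    unfolding singular_simplex_top_of_set path_simplex_def by (auto cong: continuous_on_cong)
qed

lemma singular_simplex_tri_simplex:
  assumes "continuous_on tri \<tau>" "\<tau> ` tri \<subseteq> S"
  shows "singular_simplex 2 (top_of_set S) (tri_simplex \<tau>)"
proof -
  have im: "(\<lambda>x. (x 1, x 2)) ` standard_simplex 2 \<subseteq> tri" by (auto simp: standard_simplex_2_iff)
  have "continuous_on (standard_simplex 2) (\<lambda>x. \<tau> (x 1, x 2))"
    using assms(1)
    by (rule continuous_on_compose2[OF _ _ im]) (intro continuous_on_Pair continuous_on_subset[OF continuous_on_product_coordinates subset_UNIV])
  moreover have "\<tau> (x 1, x 2) \<in> S" if "x \<in> standard_simplex 2" for x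
    using assms(2) im that by blast
  ultimately show ?thesis
    unfolding singular_simplex_top_of_set tri_simplex_def by (auto cong: continuous_on_cong)
qed

lemma singular_1_simplex_cases:
  assumes "singular_simplex 1 (top_of_set S) f"
  obtains p where "path p" "path_image p \<subseteq> S" "f = path_simplex p"
proof -
  have f: "continuous_on (standard_simplex 1) f" "f ` standard_simplex 1 \<subseteq> S" "f \<in> extensional (standard_simplex 1)"
    using assms unfolding singular_simplex_top_of_set by auto
  show ?thesis
  proof (rule that[of "f \<circ> edge_point"])
    show "path (f \<circ> edge_point)" unfolding path_def
      by (intro continuous_on_compose continuous_on_edge_point continuous_on_subset[OF f(1)])
        (use edge_point_in in blast)
    show "path_image (f \<circ> edge_point) \<subseteq> S" using f(2) edge_point_in[simplified] by (auto simp: path_image_def)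
    show "f = path_simplex (f \<circ> edge_point)"
    proof
      fix x show "f x = path_simplex (f \<circ> edge_point) x"
        using f(3) edge_point_eq[of x] by (cases "x \<in> standard_simplex 1") (auto simp: path_simplex_def extensional_def)
    qed
  qed
qed

lemma singular_2_simplex_cases:
  assumes "singular_simplex 2 (top_of_set S) f"
  obtains \<tau> where "continuous_on tri \<tau>" "\<tau> ` tri \<subseteq> S" "f = tri_simplex \<tau>"
proof -
  have f: "continuous_on (standard_simplex 2) f" "f ` standard_simplex 2 \<subseteq> S" "f \<in> extensional (standard_simplex 2)"
    using assms unfolding singular_simplex_top_of_set by auto
  show ?thesis
  proof (rule that[of "f \<circ> tri_point"])
    show "continuous_on tri (f \<circ> tri_point)"
      by (intro continuous_on_compose continuous_on_tri_point continuous_on_subset[OF f(1)])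
        (use tri_point_in in blast)
    show "(f \<circ> tri_point) ` tri \<subseteq> S" using f(2) tri_point_in by auto
    show "f = tri_simplex (f \<circ> tri_point)"
    proof
      fix x show "f x = tri_simplex (f \<circ> tri_point) x"
        using f(3) tri_point_eq[of x] by (cases "x \<in> standard_simplex 2") (auto simp: tri_simplex_def extensional_def)
    qed
  qed
qed

text \<open>Decides when two paths are the same generator of the chain group, hence when they can
  cancel.\<close>

lemma path_simplex_eq_iff: "path_simplex p = path_simplex q \<longleftrightarrow> (\<forall>t\<in>{0..1}. p t = q t)"
proof
  assume eq: "path_simplex p = path_simplex q"
  show "\<forall>t\<in>{0..1}. p t = q t"
  proof
    fix t :: real assume "t \<in> {0..1}"
    then show "p t = q t"
      using fun_cong[OF eq, of "edge_point t"] edge_point_in[of t] by (simp add: path_simplex_def edge_point_def)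
  qed
qed (auto simp: path_simplex_def fun_eq_iff standard_simplex_1_iff[simplified])

lemma simplical_face_0_to_1:
  assumes "y \<in> standard_simplex 0"
  shows "simplical_face 0 y 1 = 1" "simplical_face 1 y 1 = 0"
  using assms by (auto simp: simplical_face_def standard_simplex_0)

lemma chain_boundary_path_chain:
  "chain_boundary 1 (path_chain p) = frag_of (point_simplex (p 1)) - frag_of (point_simplex (p 0))"
proof -
  have "singular_face 1 0 (path_simplex p) = point_simplex (p 1)"
    "singular_face 1 1 (path_simplex p) = point_simplex (p 0)"
    unfolding singular_face_def point_simplex_def path_simplex_def
    using simplical_face_in_standard_simplex[of 1 0] simplical_face_in_standard_simplex[of 1 1]
    by (auto simp: fun_eq_iff simplical_face_0_to_1 simp flip: One_nat_def)
  then show ?thesis by (simp add: chain_boundary_of)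
qed

text \<open>The faces opposite vertices 0, 1 and 2 in this order, each run through from its lower to
  its higher vertex.\<close>

definition tri_boundary :: "(real \<times> real \<Rightarrow> 'a) \<Rightarrow> 'a chain" where
  "tri_boundary \<tau> = path_chain (\<lambda>t. \<tau> (1 - t, t)) - path_chain (\<lambda>t. \<tau> (0, t)) + path_chain (\<lambda>t. \<tau> (t, 0))"

lemma chain_boundary_tri_simplex: "chain_boundary 2 (frag_of (tri_simplex \<tau>)) = tri_boundary \<tau>"
proof -
  have *: "simplical_face k x \<in> standard_simplex 2" if "k \<le> 2" "x \<in> standard_simplex (Suc 0)" for k x
    using simplical_face_in_standard_simplex[of 2 k x] that by simp
  have "singular_face 2 0 (tri_simplex \<tau>) = path_simplex (\<lambda>t. \<tau> (1 - t, t))"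
    "singular_face 2 1 (tri_simplex \<tau>) = path_simplex (\<lambda>t. \<tau> (0, t))"
    "singular_face 2 2 (tri_simplex \<tau>) = path_simplex (\<lambda>t. \<tau> (t, 0))"
    using * standard_simplex_1_iff[simplified]
    by (auto simp: singular_face_def path_simplex_def tri_simplex_def restrict_def fun_eq_iff)
      (auto simp: simplical_face_def)
  then show ?thesis by (simp add: chain_boundary_of numeral_2_eq_2 tri_boundary_def)
qed

lemma singular_boundary_tri_boundary:
  assumes "continuous_on tri \<tau>" "\<tau> ` tri \<subseteq> S"
  shows "singular_relboundary 1 (top_of_set S) {} (tri_boundary \<tau>)"
  unfolding singular_boundary chain_boundary_tri_simplex[symmetric]
  using singular_simplex_tri_simplex[OF assms]
  by (intro exI[of _ "frag_of (tri_simplex \<tau>)"]) (simp add: singular_chain_of numeral_2_eq_2)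

text \<open>Map the triangle affinely to the unit interval, its vertices going to \<open>a\<close>,
  \<open>b\<close>, \<open>c\<close>, and apply \<open>p\<close>. The three points may come in any
  order: \<open>0, 1/2, 1\<close> gives concatenation and \<open>0, 1, 0\<close> gives
  reversal.\<close>

lemma singular_boundary_subpaths:
  fixes p :: "real \<Rightarrow> 'a::real_normed_vector"
  assumes p: "path p" "path_image p \<subseteq> S" and abc: "a \<in> {0..1}" "b \<in> {0..1}" "c \<in> {0..1}"
  shows "singular_relboundary 1 (top_of_set S) {}
    (path_chain (subpath b c p) - path_chain (subpath a c p) + path_chain (subpath a b p))"
proof -
  define \<tau> where "\<tau> x = p (a + fst x * (b - a) + snd x * (c - a))" for x :: "real \<times> real"
  have in01: "a + u * (b - a) + v * (c - a) \<in> {0..1}" if "(u, v) \<in> tri" for u v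
  proof -
    have uv: "u \<ge> 0" "v \<ge> 0" "1 - u - v \<ge> 0" using that by (auto simp: tri_def)
    have eq: "a + u * (b - a) + v * (c - a) = (1 - u - v) * a + u * b + v * c" by (simp add: algebra_simps)
    have "(1 - u - v) * a + u * b + v * c \<ge> 0" using uv abc by (auto intro!: add_nonneg_nonneg mult_nonneg_nonneg)
    moreover have "(1 - u - v) * a + u * b + v * c \<le> (1 - u - v) * 1 + u * 1 + v * 1"
      using uv abc by (intro add_mono mult_left_mono) auto
    ultimately show ?thesis unfolding eq by simp
  qed
  have "continuous_on tri \<tau>" unfolding \<tau>_def
    by (rule continuous_on_compose2[OF p(1)[unfolded path_def]])
      (use in01 in \<open>auto intro!: continuous_intros\<close>)
  moreover have "\<tau> ` tri \<subseteq> S" using in01 p(2) unfolding path_image_def \<tau>_def by fastforce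
  ultimately have "singular_relboundary 1 (top_of_set S) {} (tri_boundary \<tau>)"
    by (rule singular_boundary_tri_boundary)
  moreover have "(\<lambda>t. \<tau> (1 - t, t)) = subpath b c p" "(\<lambda>t. \<tau> (0, t)) = subpath a c p"
    "(\<lambda>t. \<tau> (t, 0)) = subpath a b p"
    unfolding \<tau>_def subpath_def by (auto intro!: arg_cong[of _ _ p] simp: algebra_simps)
  ultimately show ?thesis unfolding tri_boundary_def by simp
qed

text \<open>A constant triangle has three equal faces with signs plus, minus, plus, so one of them
  is left.\<close>

lemma singular_boundary_const_path:
  assumes "a \<in> S"
  shows "singular_relboundary 1 (top_of_set S) {} (path_chain (\<lambda>_. a))"
  using singular_boundary_tri_boundary[of "\<lambda>_. a" S] assms by (auto simp: tri_boundary_def)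

lemma singular_boundary_joinpaths:
  fixes p :: "real \<Rightarrow> 'a::real_normed_vector"
  assumes "path p" "path q" "path_image p \<subseteq> S" "path_image q \<subseteq> S" "pathfinish p = pathstart q"
  shows "singular_relboundary 1 (top_of_set S) {} (path_chain (p +++ q) - path_chain p - path_chain q)"
proof -
  have pq: "path (p +++ q)" "path_image (p +++ q) \<subseteq> S"
    using assms by (auto simp: path_image_join)
  have "path_simplex (subpath 0 (1/2) (p +++ q)) = path_simplex p"
    "path_simplex (subpath (1/2) 1 (p +++ q)) = path_simplex q"
    unfolding path_simplex_eq_iff using assms(5)
    by (auto simp: subpath_def joinpaths_def pathstart_def pathfinish_def)
  then have "singular_relboundary 1 (top_of_set S) {} (path_chain q - path_chain (p +++ q) + path_chain p)"
    using singular_boundary_subpaths[OF pq, of 0 "1/2" 1] by (simp add: subpath_def)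
  then show ?thesis
    using singular_relboundary_minus[of 1 _ _ "path_chain q - path_chain (p +++ q) + path_chain p"]
    by (simp add: algebra_simps)
qed

lemma singular_boundary_reversepath:
  fixes p :: "real \<Rightarrow> 'a::real_normed_vector"
  assumes "path p" "path_image p \<subseteq> S"
  shows "singular_relboundary 1 (top_of_set S) {} (path_chain p + path_chain (reversepath p))"
proof -
  have "pathstart p \<in> S" using assms by auto
  then have "singular_relboundary 1 (top_of_set S) {} (path_chain (\<lambda>_. p 0))"
    using singular_boundary_const_path by (auto simp: pathstart_def)
  moreover have "singular_relboundary 1 (top_of_set S) {} (path_chain (reversepath p) - path_chain (\<lambda>_. p 0) + path_chain p)"
    using singular_boundary_subpaths[OF assms, of 0 1 0] by (simp add: subpath_def reversepath_def)
  ultimately have "singular_relboundary 1 (top_of_set S) {} (path_chain (\<lambda>_. p 0) +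
      (path_chain (reversepath p) - path_chain (\<lambda>_. p 0) + path_chain p))"
    by (rule singular_relboundary_add)
  then show ?thesis by (simp add: algebra_simps)
qed

section \<open>Torsion in first homology at the level of chains\<close>

definition torsion_boundary :: "'a topology \<Rightarrow> 'a chain \<Rightarrow> bool" where
  "torsion_boundary X c \<longleftrightarrow> (\<exists>n::nat>0. singular_relboundary 1 X {} (frag_cmul (int n) c))"

lemma singular_boundary_imp_torsion_boundary:
  "singular_relboundary 1 X {} c \<Longrightarrow> torsion_boundary X c"
  unfolding torsion_boundary_def by (intro exI[of _ 1]) simp

lemma torsion_boundary_cmul:
  assumes "torsion_boundary X c" shows "torsion_boundary X (frag_cmul k c)"
  using assms singular_relboundary_cmul[of 1 X "{}" _ k] unfolding torsion_boundary_def
  by (metis frag_cmul_cmul mult.commute)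

lemma torsion_boundary_add:
  assumes "torsion_boundary X a" "torsion_boundary X b" shows "torsion_boundary X (a + b)"
proof -
  obtain m n :: nat where m: "m > 0" "singular_relboundary 1 X {} (frag_cmul (int m) a)"
    and n: "n > 0" "singular_relboundary 1 X {} (frag_cmul (int n) b)"
    using assms unfolding torsion_boundary_def by blast
  have "singular_relboundary 1 X {} (frag_cmul (int n) (frag_cmul (int m) a) + frag_cmul (int m) (frag_cmul (int n) b))"
    by (intro singular_relboundary_add singular_relboundary_cmul m n)
  then have "singular_relboundary 1 X {} (frag_cmul (int (m * n)) (a + b))"
    by (simp add: frag_cmul_distrib2 mult.commute)
  then show ?thesis using m n unfolding torsion_boundary_def by (intro exI[of _ "m * n"]) simp
qed

lemma torsion_boundary_minus: "torsion_boundary X c \<Longrightarrow> torsion_boundary X (- c)"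
  using torsion_boundary_cmul[of X c "-1"] by simp

lemma torsion_boundary_diff:
  "torsion_boundary X a \<Longrightarrow> torsion_boundary X b \<Longrightarrow> torsion_boundary X (a - b)"
  using torsion_boundary_add[of X a "- b"] torsion_boundary_minus[of X b] by simp

lemma torsion_boundary_0: "torsion_boundary X 0"
  by (rule singular_boundary_imp_torsion_boundary) simp

text \<open>Chain groups are free abelian: if a positive multiple of the boundary of
  \<open>c\<close> vanishes, so does the boundary itself.\<close>

lemma torsion_boundary_imp_cycle:
  assumes "torsion_boundary X c" shows "singular_relcycle 1 X {} c"
proof -
  obtain n :: nat where n: "n > 0" "singular_relboundary 1 X {} (frag_cmul (int n) c)"
    using assms unfolding torsion_boundary_def by blast
  have "singular_relcycle 1 X {} (frag_cmul (int n) c)"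
    using n by (intro singular_relboundary_imp_relcycle)
  then show ?thesis using n(1)
    by (auto simp: singular_cycle chain_boundary_cmul singular_chain_def subset_iff)
qed

lemma singular_relcycle_loop:
  assumes "path p" "path_image p \<subseteq> S" "pathstart p = pathfinish p"
  shows "singular_relcycle 1 (top_of_set S) {} (path_chain p)"
  using assms singular_simplex_path_simplex[OF assms(1,2)] chain_boundary_path_chain[of p]
  by (auto simp: singular_cycle singular_chain_of pathstart_def pathfinish_def)

lemma homology_group_1_alt:
  "homology_group 1 X = relcycle_group 1 X {} Mod singular_relboundary_set 1 X {}"
  using nontrivial_relative_homology_group[of 1 X "{}"] by simp

text \<open>The bridge between chains and the quotient group: pass to the coset of the boundaries,
  then to the coset of the torsion subgroup. Both halves of the dichotomy work with cycles and enter
  the group through \<open>\<theta>\<close>.\<close>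

lemma cycle_to_tf_homology:
  obtains \<theta> where "\<theta> \<in> hom (relcycle_group 1 X {}) (tf (homology_group 1 X))"
    "\<theta> ` singular_relcycle_set 1 X {} = carrier (tf (homology_group 1 X))"
    "\<And>c. singular_relcycle 1 X {} c \<Longrightarrow> \<theta> c = \<one>\<^bsub>tf (homology_group 1 X)\<^esub> \<longleftrightarrow> torsion_boundary X c"
    "\<And>a b. singular_relcycle 1 X {} a \<Longrightarrow> singular_relcycle 1 X {} b \<Longrightarrow>
      \<theta> (a - b) = \<theta> a \<otimes>\<^bsub>tf (homology_group 1 X)\<^esub> inv\<^bsub>tf (homology_group 1 X)\<^esub> \<theta> b"
proof -
  let ?Z = "relcycle_group 1 X {}" and ?B = "singular_relboundary_set 1 X {}" and ?H = "homology_group 1 X"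
  interpret H: comm_group ?H by (rule abelian_homology_group)
  interpret B: normal ?B ?Z by (rule normal_subgroup_singular_relboundary_relcycle)
  define \<rho> where "\<rho> a = ?B #>\<^bsub>?Z\<^esub> a" for a
  define \<theta> where "\<theta> a = tor ?H #>\<^bsub>?H\<^esub> \<rho> a" for a
  have \<rho>: "\<rho> \<in> hom ?Z ?H" unfolding \<rho>_def homology_group_1_alt by (rule B.r_coset_hom_Mod)
  have \<rho>s: "\<rho> ` carrier ?Z = carrier ?H" unfolding \<rho>_def homology_group_1_alt by (simp add: carrier_FactGroup)
  have \<theta>: "\<theta> = (\<lambda>a. tor ?H #>\<^bsub>?H\<^esub> a) \<circ> \<rho>" by (auto simp: \<theta>_def)
  have pw: "c [^]\<^bsub>?Z\<^esub> n = frag_cmul (int n) c" for c and n :: nat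
    by (induction n) (simp_all add: frag_cmul_distrib add.commute)
  have \<theta>h: "\<theta> \<in> hom ?Z (tf ?H)" unfolding \<theta> using \<rho> H.hom_tor_coset Group.hom_compose by blast
  show ?thesis
  proof (rule that[of \<theta>])
    show "\<theta> \<in> hom ?Z (tf ?H)" by (rule \<theta>h)
    show "\<theta> ` singular_relcycle_set 1 X {} = carrier (tf ?H)"
      using \<rho>s H.surj_tor_coset unfolding \<theta> image_comp[symmetric] by simp
    interpret T: comm_group "tf ?H" by (rule H.comm_group_tf)
    interpret \<theta>: group_hom ?Z "tf ?H" \<theta>
      using \<theta>h by (simp add: group_hom_def group_hom_axioms_def T.is_group)
    show "\<theta> (a - b) = \<theta> a \<otimes>\<^bsub>tf ?H\<^esub> inv\<^bsub>tf ?H\<^esub> \<theta> b"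
      if "singular_relcycle 1 X {} a" "singular_relcycle 1 X {} b" for a b
    proof -
      have ab: "singular_relcycle 1 X {} (a - b)" using that singular_relcycle_diff by blast
      then have "\<theta> a = \<theta> (a - b) \<otimes>\<^bsub>tf ?H\<^esub> \<theta> b"
        using \<theta>.hom_mult[of "a - b" b] that by simp
      moreover have "\<theta> b \<in> carrier (tf ?H)" "\<theta> (a - b) \<in> carrier (tf ?H)"
        using \<theta>.hom_closed[of b] \<theta>.hom_closed[of "a - b"] that ab by auto
      ultimately show ?thesis by (simp add: T.m_assoc)
    qed
    fix c assume c: "singular_relcycle 1 X {} c"
    then have \<rho>c: "\<rho> c \<in> carrier ?H" using \<rho>s by auto
    have "\<rho> c [^]\<^bsub>?H\<^esub> n = \<one>\<^bsub>?H\<^esub> \<longleftrightarrow> singular_relboundary 1 X {} (frag_cmul (int n) c)" for n :: nat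
    proof -
      have "\<rho> c [^]\<^bsub>?H\<^esub> n = \<rho> (frag_cmul (int n) c)"
        using B.FactGroup_pow[of c n] c unfolding \<rho>_def homology_group_1_alt pw by simp
      also have "\<dots> = homologous_rel_set 1 X {} (frag_cmul (int n) c)"
        unfolding \<rho>_def right_coset_singular_relboundary ..
      finally show ?thesis unfolding homology_group_1_alt by (simp add: homologous_rel_set_eq_relboundary)
    qed
    then show "\<theta> c = \<one>\<^bsub>tf ?H\<^esub> \<longleftrightarrow> torsion_boundary X c"
      unfolding \<theta>_def H.tor_coset_eq_one_iff[OF \<rho>c] torsion_boundary_def using \<rho>c by (auto simp: tor_def)
  qed
qed

subsection \<open>Finite generation when small loops are torsion\<close>

definition connects :: "'a::topological_space set \<Rightarrow> 'a \<Rightarrow> 'a \<Rightarrow> (real \<Rightarrow> 'a) \<Rightarrow> bool" where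
  "connects S x y p \<longleftrightarrow> path p \<and> path_image p \<subseteq> S \<and> pathstart p = x \<and> pathfinish p = y"

lemma connects_joinpaths: "connects S x y p \<Longrightarrow> connects S y z q \<Longrightarrow> connects S x z (p +++ q)"
  by (auto simp: connects_def path_image_join)

lemma connects_reversepath: "connects S x y p \<Longrightarrow> connects S y x (reversepath p)"
  by (auto simp: connects_def)

lemma connects_subset: "connects S x y p \<Longrightarrow> S \<subseteq> T \<Longrightarrow> connects T x y p"
  by (auto simp: connects_def)

lemma path_connected_space_connects:
  assumes "path_connected_space (top_of_set S)" "x \<in> S" "y \<in> S"
  shows "\<exists>p. connects S x y p"
  using assms unfolding path_connected_space_def pathin_canon_iff connects_def
  by (fastforce simp: path_image_def pathstart_def pathfinish_def)

text \<open>\<open>d\<close> is a Lebesgue number for a cover by open sets with small path connected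
  traces on \<open>S\<close>. A trace inside a ball of radius \<open>e / 2\<close> lies within
  \<open>e\<close> of each of its points.\<close>

lemma uniformly_locally_path_connected:
  fixes S :: "'a::metric_space set"
  assumes S: "compact S" "locally_path_connected_space (top_of_set S)" and e: "0 < e"
  shows "\<exists>d>0. \<forall>x\<in>S. \<forall>y\<in>S. dist x y < d \<longrightarrow> (\<exists>p. connects (S \<inter> ball x e) x y p)"
proof -
  define \<G> where "\<G> = {O'. open O' \<and> (\<exists>z. S \<inter> O' \<subseteq> ball z (e / 2) \<and> path_connectedin (top_of_set S) (S \<inter> O'))}"
  have cover: "S \<subseteq> \<Union>\<G>"
  proof
    fix z assume z: "z \<in> S"
    have "openin (top_of_set S) (S \<inter> ball z (e / 2))" "z \<in> S \<inter> ball z (e / 2)"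
      using z e by auto
    then obtain U where U: "openin (top_of_set S) U" "path_connectedin (top_of_set S) U" "z \<in> U" "U \<subseteq> S \<inter> ball z (e / 2)"
      using S(2) unfolding locally_path_connected_space by meson
    then obtain O' where "open O'" "U = S \<inter> O'" by (auto simp: openin_open)
    then have "O' \<in> \<G>" "z \<in> O'" using U unfolding \<G>_def by auto
    then show "z \<in> \<Union>\<G>" by blast
  qed
  have op: "open G" if "G \<in> \<G>" for G
    using that by (simp add: \<G>_def)
  obtain d where d: "d > 0" "\<And>x. x \<in> S \<Longrightarrow> \<exists>G\<in>\<G>. ball x d \<subseteq> G"
    using Heine_Borel_lemma[OF S(1) cover op] by blast
  have "\<exists>p. connects (S \<inter> ball x e) x y p" if xy: "x \<in> S" "y \<in> S" "dist x y < d" for x y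
  proof -
    obtain G z where G: "ball x d \<subseteq> G" "S \<inter> G \<subseteq> ball z (e / 2)" "path_connectedin (top_of_set S) (S \<inter> G)"
      using d(2)[OF xy(1)] unfolding \<G>_def by auto
    have "x \<in> S \<inter> G" "y \<in> S \<inter> G" using xy d(1) G(1) by auto
    then obtain p where p: "pathin (top_of_set S) p" "p \<in> {0..1} \<rightarrow> S \<inter> G" "p 0 = x" "p 1 = y"
      using G(3) unfolding path_connectedin by blast
    have "S \<inter> G \<subseteq> ball x e"
    proof
      fix w assume "w \<in> S \<inter> G"
      then have "dist z w < e / 2" "dist z x < e / 2" using G(2) \<open>x \<in> S \<inter> G\<close> by auto
      then show "w \<in> ball x e" using dist_triangle[of x w z] by (simp add: dist_commute)
    qed
    then have "connects (S \<inter> ball x e) x y p"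
      using p unfolding connects_def pathin_canon_iff path_image_def pathstart_def pathfinish_def by auto
    then show ?thesis by blast
  qed
  then show ?thesis using d(1) by blast
qed

definition small_loops_torsion :: "'a::metric_space set \<Rightarrow> real \<Rightarrow> bool" where
  "small_loops_torsion S e \<longleftrightarrow>
     (\<forall>x\<in>S. \<forall>p. connects (S \<inter> ball x e) x x p \<longrightarrow> torsion_boundary (top_of_set S) (path_chain p))"

lemma torsion_boundary_joinpaths:
  fixes S :: "'a::real_normed_vector set"
  assumes "connects S x y p" "connects S y z q"
  shows "torsion_boundary (top_of_set S) (path_chain (p +++ q) - path_chain p - path_chain q)"
  using assms unfolding connects_def
  by (intro singular_boundary_imp_torsion_boundary singular_boundary_joinpaths) auto

lemma torsion_boundary_reversepath:
  fixes S :: "'a::real_normed_vector set"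
  assumes "connects S x y p"
  shows "torsion_boundary (top_of_set S) (path_chain p + path_chain (reversepath p))"
  using assms unfolding connects_def
  by (intro singular_boundary_imp_torsion_boundary singular_boundary_reversepath) auto

lemma torsion_boundary_join_reversepath:
  fixes S :: "'a::real_normed_vector set"
  assumes p: "connects S x y p" and q: "connects S z y q"
  shows "torsion_boundary (top_of_set S) (path_chain (p +++ reversepath q) - path_chain p + path_chain q)"
  using torsion_boundary_add[OF torsion_boundary_joinpaths[OF p connects_reversepath[OF q]] torsion_boundary_reversepath[OF q]]
  by (simp add: algebra_simps)

lemma torsion_boundary_small_paths:
  fixes S :: "'a::real_normed_vector set"
  assumes e: "small_loops_torsion S e" and x: "x \<in> S"
    and p: "connects (S \<inter> ball x e) x y p" and q: "connects (S \<inter> ball x e) x y q"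
  shows "torsion_boundary (top_of_set S) (path_chain p - path_chain q)"
proof -
  have S: "connects S x y p" "connects S x y q" using p q connects_subset by blast+
  have "connects (S \<inter> ball x e) x x (p +++ reversepath q)"
    using connects_joinpaths[OF p connects_reversepath[OF q]] .
  then have "torsion_boundary (top_of_set S) (path_chain (p +++ reversepath q))"
    using e x unfolding small_loops_torsion_def by blast
  from torsion_boundary_diff[OF this torsion_boundary_join_reversepath[OF S]]
  show ?thesis by (simp add: algebra_simps)
qed

text \<open>If all small loops are torsion, a path can be replaced, modulo torsion, by a polygonal path on a
  finite net; closing up its edges by fixed paths to a base point gives finitely many generators.\<close>

lemma finitely_many_cycles_generate:
  fixes S :: "'a::real_normed_vector set"
  assumes S: "compact S" "path_connected_space (top_of_set S)" "locally_path_connected_space (top_of_set S)"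
    and e: "0 < e" "small_loops_torsion S e"
  obtains L where "finite L" "\<And>l. l \<in> L \<Longrightarrow> singular_relcycle 1 (top_of_set S) {} l"
    "\<And>K c. \<lbrakk>\<And>a b. a \<in> K \<Longrightarrow> b \<in> K \<Longrightarrow> a - b \<in> K; \<And>c. torsion_boundary (top_of_set S) c \<Longrightarrow> c \<in> K; L \<subseteq> K;
      singular_relcycle 1 (top_of_set S) {} c\<rbrakk> \<Longrightarrow> c \<in> K"
proof -
  let ?X = "top_of_set S"
  obtain d0 where d0: "d0 > 0" "\<And>x y. x \<in> S \<Longrightarrow> y \<in> S \<Longrightarrow> dist x y < d0 \<Longrightarrow> \<exists>p. connects (S \<inter> ball x (e/4)) x y p"
    using uniformly_locally_path_connected[OF S(1,3), of "e/4"] e by auto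
  \<comment> \<open>The net will have mesh \<open>d/3\<close>: three steps of that length, from
    \<open>q x\<close> over \<open>x\<close> and \<open>y\<close> to \<open>q y\<close>, stay below
    \<open>d \<le> d0\<close>, where short paths exist. And \<open>d \<le> e\<close> gives
    \<open>d/3 + e/4 < e\<close>, so those paths stay in \<open>ball x e\<close>.\<close>
  define d where "d = min d0 e"
  have d: "d > 0" "d \<le> e" using d0 e by (auto simp: d_def)
  define E where "E x y = (SOME p. connects (S \<inter> ball x (e/4)) x y p)" for x y
  have E: "connects (S \<inter> ball x (e/4)) x y (E x y)" if "x \<in> S" "y \<in> S" "dist x y < d" for x y
  proof -
    have "dist x y < d0" using that(3) by (simp add: d_def)
    from someI_ex[OF d0(2)[OF that(1,2) this]] show ?thesis unfolding E_def .
  qed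
  obtain Q where Q: "finite Q" "Q \<subseteq> S" "S \<subseteq> (\<Union>x\<in>Q. ball x (d/3))"
    using compactE_image[OF S(1), of S "\<lambda>x. ball x (d/3)"] d by (metis UN_I centre_in_ball divide_pos_pos open_ball subsetI zero_less_numeral)
  define q where "q x = (SOME y. y \<in> Q \<and> dist x y < d/3)" for x
  have q: "q x \<in> Q" "dist x (q x) < d/3" if "x \<in> S" for x
  proof -
    obtain y where "y \<in> Q" "x \<in> ball y (d/3)" using Q(3) \<open>x \<in> S\<close> by blast
    then have "\<exists>y. y \<in> Q \<and> dist x y < d/3" by (auto simp: dist_commute)
    from someI_ex[OF this] show "q x \<in> Q" "dist x (q x) < d/3" unfolding q_def by auto
  qed
  have qS: "q x \<in> S" if "x \<in> S" for x using q[OF that] Q by blast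
  define x0 where "x0 = (SOME x. x \<in> S)"
  have x0: "x0 \<in> S" if "x \<in> S" for x unfolding x0_def using that by (metis someI)
  define \<beta> where "\<beta> a = (SOME p. connects S x0 a p)" for a
  have \<beta>: "connects S x0 a (\<beta> a)" if "a \<in> S" for a
    unfolding \<beta>_def using path_connected_space_connects[OF S(2) x0[OF that] that] by (rule someI_ex)
  \<comment> \<open>\<open>G x\<close> is a 1-chain leading from \<open>x\<close> over its net point
    to the base point \<open>x0\<close>. Thus \<open>G x - G y\<close> has the boundary of a path
    from \<open>x\<close> to \<open>y\<close>, and subtracting it from such a path leaves a
    cycle.\<close>
  define G where "G x = path_chain (E x (q x)) - path_chain (\<beta> (q x))" for x
  define l where "l a b = path_chain (\<beta> a) + path_chain (E a b) - path_chain (\<beta> b)" for a b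
  define L where "L = {l a b |a b. a \<in> Q \<and> b \<in> Q \<and> dist a b < d}"
  have pcyc: "chain_boundary 1 (path_chain p) = frag_of (point_simplex y) - frag_of (point_simplex x) \<and> singular_chain 1 ?X (path_chain p)"
    if "connects S x y p" for x y p
    using that chain_boundary_path_chain[of p] singular_simplex_path_simplex[of p S]
    by (auto simp: connects_def singular_chain_of pathstart_def pathfinish_def)
  show ?thesis
  proof (rule that[of L])
    have "L \<subseteq> (\<lambda>(a, b). l a b) ` (Q \<times> Q)" by (auto simp: L_def)
    then show "finite L" using Q(1) by (meson finite_SigmaI finite_imageI finite_subset)
    fix z assume "z \<in> L"
    then obtain a b where ab: "z = l a b" "a \<in> S" "b \<in> S" "dist a b < d" using Q(2) by (auto simp: L_def)
    have Eab: "connects S a b (E a b)" using E[OF ab(2-4)] connects_subset by blast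
    show "singular_relcycle 1 ?X {} z"
      unfolding ab(1) l_def singular_cycle
      using pcyc[OF \<beta>[OF ab(2)]] pcyc[OF \<beta>[OF ab(3)]] pcyc[OF Eab]
      by (simp add: chain_boundary_add chain_boundary_diff singular_chain_add singular_chain_diff)
  next
    fix K c
    assume diff: "\<And>a b. a \<in> K \<Longrightarrow> b \<in> K \<Longrightarrow> a - b \<in> K" and tor: "\<And>c. torsion_boundary ?X c \<Longrightarrow> c \<in> K"
      and L: "L \<subseteq> K" and c: "singular_relcycle 1 ?X {} c"
    have zero: "0 \<in> K" using tor torsion_boundary_0 by blast
    have add: "a + b \<in> K" if "a \<in> K" "b \<in> K" for a b
      using diff[OF that(1) diff[OF zero that(2)]] by simp
    have small: "path_chain r - (G x - G y) \<in> K"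
      if r: "connects (S \<inter> ball x (e/4)) x y r" and xy: "x \<in> S" "y \<in> S" "dist x y < d/3" for x y r
    proof -
      have dq: "dist (q x) (q y) < d" 
        using dist_triangle[of "q x" "q y" x] dist_triangle[of x "q y" y] q(2)[OF xy(1)] q(2)[OF xy(2)] xy(3)
        by (simp add: dist_commute)
      have dx: "dist x (q x) < d" "dist y (q y) < d" using q(2)[OF xy(1)] q(2)[OF xy(2)] d(1) by linarith+
      have sub: "S \<inter> ball w (e/4) \<subseteq> S \<inter> ball x e" if "dist x w < d/3" for w
      proof -
        have "ball w (e/4) \<subseteq> ball x e"
          using that d by (auto intro!: subsetI) (smt (verit) dist_triangle dist_commute field_sum_of_halves)
        then show ?thesis by blast
      qed
      have E1: "connects (S \<inter> ball x e) x (q x) (E x (q x))"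
        using E[OF xy(1) qS[OF xy(1)] dx(1)] sub[of x] d connects_subset by (metis dist_self divide_pos_pos zero_less_numeral)
      have E2: "connects (S \<inter> ball x e) (q x) (q y) (E (q x) (q y))"
        using E[OF qS[OF xy(1)] qS[OF xy(2)] dq] sub[OF q(2)[OF xy(1)]] connects_subset by blast
      have E3: "connects (S \<inter> ball x e) y (q y) (E y (q y))"
        using E[OF xy(2) qS[OF xy(2)] dx(2)] sub[OF xy(3)] connects_subset by blast
      have r': "connects (S \<inter> ball x e) x y r"
        using r sub[of x] d connects_subset by (metis dist_self divide_pos_pos zero_less_numeral)
      \<comment> \<open>The detour through the net has the same end points as \<open>r\<close> and
        stays in \<open>ball x e\<close>, so the hypothesis on small loops makes the two agree
        modulo torsion.\<close>
      let ?w = "(E x (q x) +++ E (q x) (q y)) +++ reversepath (E y (q y))"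
      have w: "connects (S \<inter> ball x e) x y ?w"
        by (intro connects_joinpaths[OF connects_joinpaths[OF E1 E2]] connects_reversepath E3)
      have S': "connects S u v p" if "connects (S \<inter> ball x e) u v p" for u v p
        using that connects_subset by blast
      have "torsion_boundary ?X ((path_chain r - path_chain ?w) +
          (path_chain ?w - path_chain (E x (q x) +++ E (q x) (q y)) + path_chain (E y (q y))) +
          (path_chain (E x (q x) +++ E (q x) (q y)) - path_chain (E x (q x)) - path_chain (E (q x) (q y))))"
        by (intro torsion_boundary_add torsion_boundary_small_paths[OF e(2) xy(1) r' w]
            torsion_boundary_join_reversepath[OF S'[OF connects_joinpaths[OF E1 E2]] S'[OF E3]]
            torsion_boundary_joinpaths[OF S'[OF E1] S'[OF E2]])
      then have "path_chain r - path_chain (E x (q x)) - path_chain (E (q x) (q y)) + path_chain (E y (q y)) \<in> K"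
        by (intro tor) (simp add: algebra_simps)
      moreover have "l (q x) (q y) \<in> K" using L q(1)[OF xy(1)] q(1)[OF xy(2)] dq by (auto simp: L_def)
      ultimately have "(path_chain r - path_chain (E x (q x)) - path_chain (E (q x) (q y)) + path_chain (E y (q y)))
          + l (q x) (q y) \<in> K" by (rule add)
      then show ?thesis unfolding G_def l_def by (simp add: algebra_simps)
    qed
    have big: "path_chain p - (G (p 0) - G (p 1)) \<in> K" if p: "path p" "path_image p \<subseteq> S" for p
    proof -
      \<comment> \<open>\<open>d/3\<close> keeps consecutive subdivision points close enough for
        \<open>small\<close>, and \<open>e/4\<close> keeps the piece between them in the ball
        required there.\<close>
      define \<eta> where "\<eta> = min (d/3) (e/4)"
      have \<eta>: "\<eta> > 0" using d e by (simp add: \<eta>_def)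
      have "uniformly_continuous_on {0..1} p"
        using p(1) unfolding path_def by (intro compact_uniformly_continuous) auto
      then obtain \<delta> where \<delta>: "\<delta> > 0" "\<And>s t. s \<in> {0..1} \<Longrightarrow> t \<in> {0..1} \<Longrightarrow> dist t s < \<delta> \<Longrightarrow> dist (p t) (p s) < \<eta>"
        using \<eta> unfolding uniformly_continuous_on_def by blast
      obtain N where N: "N > 0" "1 / real N < \<delta>" using \<delta>(1) real_arch_inverse[of \<delta>] by (auto simp: inverse_eq_divide)
      define t where "t k = real k / real N" for k
      have tin: "t k \<in> {0..1}" if "k \<le> N" for k using that N(1) by (auto simp: t_def)
      have pS: "p s \<in> S" if "s \<in> {0..1}" for s using p(2) that unfolding path_image_def by blast
      have "path_chain (subpath 0 (t k) p) - (G (p 0) - G (p (t k))) \<in> K" if "k \<le> N" for k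
        using that
      proof (induction k)
        case 0
        have "torsion_boundary ?X (path_chain (subpath 0 0 p))"
          using singular_boundary_const_path[of "p 0" S] pS[of 0]
          by (auto simp: subpath_def intro: singular_boundary_imp_torsion_boundary)
        then show ?case using tor by (simp add: t_def)
      next
        case (Suc k)
        have k: "t k \<in> {0..1}" "t (Suc k) \<in> {0..1}" using Suc.prems tin by auto
        have tk: "t (Suc k) = t k + 1 / real N" by (simp add: t_def add_divide_distrib)
        have near: "dist (p (t k)) (p s) < \<eta>" if "s \<in> {t k..t (Suc k)}" for s
          by (rule \<delta>(2)) (use that k tk N in \<open>auto simp: dist_real_def\<close>)
        have "connects (S \<inter> ball (p (t k)) (e/4)) (p (t k)) (p (t (Suc k))) (subpath (t k) (t (Suc k)) p)"
          unfolding connects_def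
        proof (intro conjI)
          show "path (subpath (t k) (t (Suc k)) p)" using p k by (intro path_subpath) auto
          have "t k \<le> t (Suc k)" using tk N by simp
          then show "path_image (subpath (t k) (t (Suc k)) p) \<subseteq> S \<inter> ball (p (t k)) (e/4)"
            using near pS k by (auto simp: path_image_subpath \<eta>_def)
        qed (simp_all add: pathstart_subpath pathfinish_subpath)
        then have 1: "path_chain (subpath (t k) (t (Suc k)) p) - (G (p (t k)) - G (p (t (Suc k)))) \<in> K"
          using small[of "p (t k)" "p (t (Suc k))"] pS k near[of "t (Suc k)"] tk N by (auto simp: \<eta>_def)
        have 2: "path_chain (subpath (t k) (t (Suc k)) p) - path_chain (subpath 0 (t (Suc k)) p) + path_chain (subpath 0 (t k) p) \<in> K"
          using singular_boundary_subpaths[OF p, of 0 "t k" "t (Suc k)"] k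
          by (intro tor singular_boundary_imp_torsion_boundary) auto
        have "path_chain (subpath 0 (t k) p) - (G (p 0) - G (p (t k))) \<in> K" using Suc by simp
        from diff[OF add[OF this 1] 2] show ?case by (simp add: algebra_simps)
      qed
      from this[of N] show ?thesis using N(1) by (simp add: t_def subpath_def)
    qed
    \<comment> \<open>\<open>v0\<close> is the only point of the standard 0-simplex, so evaluating
      at it recovers the point; \<open>\<Phi>\<close> is the linear extension of \<open>G\<close> to
      0-chains.\<close>
    define v0 :: "nat \<Rightarrow> real" where "v0 = (\<lambda>j. if j = 0 then 1 else 0)"
    define \<Phi> where "\<Phi> = frag_extend (\<lambda>f. G (f v0))"
    have \<Phi>p: "\<Phi> (frag_of (point_simplex a)) = G a" for a
      by (simp add: \<Phi>_def point_simplex_def v0_def standard_simplex_0)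
    \<comment> \<open>The claim is additive in \<open>b\<close>, so it reduces to \<open>big\<close>
      for single paths. For a cycle the correction term vanishes.\<close>
    have "b + \<Phi> (chain_boundary 1 b) \<in> K" if "Poly_Mapping.keys b \<subseteq> singular_simplex_set 1 ?X" for b
    proof (rule free_Abelian_group_induct[OF that])
      fix x y assume "x + \<Phi> (chain_boundary 1 x) \<in> K" "y + \<Phi> (chain_boundary 1 y) \<in> K"
      then have "(x + \<Phi> (chain_boundary 1 x)) - (y + \<Phi> (chain_boundary 1 y)) \<in> K" by (rule diff)
      then show "x - y + \<Phi> (chain_boundary 1 (x - y)) \<in> K" by (simp add: chain_boundary_diff \<Phi>_def frag_extend_diff algebra_simps)
    next
      fix f assume "f \<in> singular_simplex_set 1 ?X"
      then obtain p where p: "path p" "path_image p \<subseteq> S" "f = path_simplex p"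
        using singular_1_simplex_cases by blast
      have bd: "\<Phi> (chain_boundary 1 (path_chain p)) = G (p 1) - G (p 0)"
        unfolding chain_boundary_path_chain by (metis \<Phi>_def \<Phi>p frag_extend_diff)
      show "frag_of f + \<Phi> (chain_boundary 1 (frag_of f)) \<in> K" using big[OF p(1,2)] unfolding p(3) bd by (simp add: algebra_simps)
    qed (simp add: zero \<Phi>_def)
    moreover have "Poly_Mapping.keys c \<subseteq> singular_simplex_set 1 ?X" "chain_boundary 1 c = 0"
      using c by (auto simp: singular_cycle singular_chain_def)
    ultimately have "c + \<Phi> 0 \<in> K" by metis
    then show "c \<in> K" by (simp add: \<Phi>_def)
  qed
qed

lemma small_loops_torsion_imp_free:
  fixes S :: "'a::real_normed_vector set"
  assumes S: "compact S" "path_connected_space (top_of_set S)" "locally_path_connected_space (top_of_set S)"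
    and e: "0 < e" "small_loops_torsion S e"
  shows "\<exists>T :: nat set. finite T \<and> tf (homology_group 1 (top_of_set S)) \<cong> free_Abelian_group T"
proof -
  let ?X = "top_of_set S" let ?H = "homology_group 1 ?X"
  interpret H: comm_group ?H by (rule abelian_homology_group)
  interpret T: comm_group "tf ?H" by (rule H.comm_group_tf)
  obtain \<theta> where \<theta>: "\<theta> \<in> hom (relcycle_group 1 ?X {}) (tf ?H)"
    "\<theta> ` singular_relcycle_set 1 ?X {} = carrier (tf ?H)"
    "\<And>c. singular_relcycle 1 ?X {} c \<Longrightarrow> \<theta> c = \<one>\<^bsub>tf ?H\<^esub> \<longleftrightarrow> torsion_boundary ?X c"
    and \<theta>diff: "\<And>a b. singular_relcycle 1 ?X {} a \<Longrightarrow> singular_relcycle 1 ?X {} b \<Longrightarrow>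
      \<theta> (a - b) = \<theta> a \<otimes>\<^bsub>tf ?H\<^esub> inv\<^bsub>tf ?H\<^esub> \<theta> b"
    using cycle_to_tf_homology[of ?X] by blast
  obtain L where L: "finite L" "\<And>l. l \<in> L \<Longrightarrow> singular_relcycle 1 ?X {} l"
    and gen: "\<And>K c. \<lbrakk>\<And>a b. a \<in> K \<Longrightarrow> b \<in> K \<Longrightarrow> a - b \<in> K; \<And>c. torsion_boundary (top_of_set S) c \<Longrightarrow> c \<in> K; L \<subseteq> K;
      singular_relcycle 1 (top_of_set S) {} c\<rbrakk> \<Longrightarrow> c \<in> K"
    using finitely_many_cycles_generate[OF S e] by blast
  interpret \<theta>: group_hom "relcycle_group 1 ?X {}" "tf ?H" \<theta>
    using \<theta>(1) by (simp add: group_hom_def group_hom_axioms_def T.is_group)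
  let ?A = "\<theta> ` L"
  have A: "?A \<subseteq> carrier (tf ?H)" using L(2) \<theta>(2) by auto
  \<comment> \<open>Cycles whose image lies in the subgroup generated by the images of
    \<open>L\<close>; torsion boundaries belong to it because they are sent to the unit.\<close>
  define K where "K = {c. singular_relcycle 1 ?X {} c \<and> \<theta> c \<in> generate (tf ?H) ?A}"
  interpret gA: subgroup "generate (tf ?H) ?A" "tf ?H" by (rule T.generate_is_subgroup[OF A])
  have "c \<in> K" if c: "singular_relcycle 1 ?X {} c" for c
  proof (rule gen[OF _ _ _ c])
    show "a - b \<in> K" if "a \<in> K" "b \<in> K" for a b
      using that \<theta>diff singular_relcycle_diff unfolding K_def by auto
    show "b \<in> K" if "torsion_boundary ?X b" for b
      using \<theta>(3)[OF torsion_boundary_imp_cycle[OF that]] that torsion_boundary_imp_cycle[OF that]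
      unfolding K_def by simp
    show "L \<subseteq> K" using L(2) unfolding K_def by (auto intro: generate.incl)
  qed
  then have "\<theta> c \<in> generate (tf ?H) ?A" if "c \<in> singular_relcycle_set 1 ?X {}" for c
    using that by (simp add: K_def)
  then have "carrier (tf ?H) \<subseteq> generate (tf ?H) ?A" unfolding \<theta>(2)[symmetric] by (rule image_subsetI)
  then have "generate (tf ?H) ?A = carrier (tf ?H)" using gA.subset by blast
  then show ?thesis
    using T.finitely_generated_torsion_free_iso[of ?A] H.tf_torsion_free L(1) A by blast
qed

subsection \<open>Infinite concatenations of shrinking loops\<close>

text \<open>Loop \<open>k\<close> occupies the times from \<open>1 - 1 / 2 ^ k\<close> to
  \<open>1 - 1 / 2 ^ Suc k\<close>. Halving the slots makes the removal of the first loop an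
  ordinary \<open>+++\<close>.\<close>

definition infinite_join :: "(nat \<Rightarrow> real \<Rightarrow> 'a) \<Rightarrow> 'a \<Rightarrow> real \<Rightarrow> 'a" where
  "infinite_join g x t = (if 1 \<le> t then x else
     let k = LEAST k. t < 1 - 1 / 2 ^ Suc k in g k (2 ^ Suc k * (t - (1 - 1 / 2 ^ k))))"

text \<open>\<open>k\<close> is chosen before \<open>g\<close> and \<open>x\<close>: the slot
  containing \<open>t\<close> is determined by \<open>t\<close> alone.\<close>

lemma infinite_join_piece:
  assumes "0 \<le> t" "t < 1"
  obtains k where "\<And>g x. infinite_join g x t = g k (2 ^ Suc k * (t - (1 - 1 / 2 ^ k)))"
    "2 ^ Suc k * (t - (1 - 1 / 2 ^ k)) \<in> {0..1::real}"
proof -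
  define P where "P k \<longleftrightarrow> t < 1 - 1 / 2 ^ Suc k" for k
  define k where "k = (LEAST k. P k)"
  obtain n where n: "(1/2::real) ^ n < 1 - t" using real_arch_pow_inv[of "1 - t" "1/2"] assms by auto
  have "(1/2::real) ^ Suc n \<le> (1/2) ^ n" by simp
  then have "P n" using n by (simp add: P_def power_one_over)
  then have Pk: "P k" unfolding k_def by (rule LeastI)
  have lo: "1 - 1 / 2 ^ k \<le> t"
  proof (cases k)
    case 0
    then show ?thesis using assms by simp
  next
    case (Suc j)
    then have "\<not> P j" using not_less_Least[of j P] k_def by simp
    then show ?thesis using Suc by (simp add: P_def)
  qed
  have "2 ^ Suc k * (t - (1 - 1 / 2 ^ k)) \<le> 2 ^ Suc k * (1 / 2 ^ k - 1 / 2 ^ Suc k)"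
    using Pk unfolding P_def by (intro mult_left_mono) auto
  also have "\<dots> = (1::real)" by (simp add: field_simps)
  finally have "2 ^ Suc k * (t - (1 - 1 / 2 ^ k)) \<in> {0..1::real}" using lo by simp
  moreover have "infinite_join g x t = g k (2 ^ Suc k * (t - (1 - 1 / 2 ^ k)))" for g and x :: 'a
    using assms by (simp add: infinite_join_def Let_def k_def P_def)
  ultimately show ?thesis using that by blast
qed

lemma infinite_join_1 [simp]: "infinite_join g x 1 = x"
  by (simp add: infinite_join_def)

lemma infinite_join_eq_joinpaths:
  assumes g: "\<And>k. g k 0 = x" "\<And>k. g k 1 = x" and t: "t \<in> {0..1}"
  shows "infinite_join g x t = (g 0 +++ infinite_join (\<lambda>k. g (Suc k)) x) t"
proof -
  consider "t < 1/2" | "t = 1/2" | "1/2 < t" "t < 1" | "t = 1" using t by fastforce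
  then show ?thesis
  proof cases
    case 1
    then have "(LEAST k. t < 1 - 1 / 2 ^ Suc k) = 0" by (intro Least_eq_0) simp
    then show ?thesis using 1 by (simp add: infinite_join_def joinpaths_def)
  next
    \<comment> \<open>At the junction the two sides evaluate different loops, \<open>g 1\<close> at
      time 0 and \<open>g 0\<close> at time 1; both values are \<open>x\<close>.\<close>
    case 2
    have L: "(LEAST k. (1/2::real) < 1 - 1 / 2 ^ Suc k) = 1"
    proof (rule Least_equality)
      show "1 \<le> y" if "(1/2::real) < 1 - 1 / 2 ^ Suc y" for y using that by (cases y) auto
    qed simp
    show ?thesis unfolding 2 infinite_join_def L Let_def using g by (simp add: joinpaths_def)
  next
    case 3
    define P where "P k \<longleftrightarrow> t < 1 - 1 / 2 ^ Suc k" for k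
    obtain n where n: "(1/2::real) ^ n < 1 - t" using real_arch_pow_inv[of "1 - t" "1/2"] 3 by auto
    have "(1/2::real) ^ Suc n \<le> (1/2) ^ n" by simp
    then have "P n" using n by (simp add: P_def power_one_over)
    moreover have "\<not> P 0" using 3 by (simp add: P_def)
    ultimately have L: "(LEAST k. P k) = Suc (LEAST k. P (Suc k))" by (rule Least_Suc)
    have PS: "P (Suc k) \<longleftrightarrow> 2 * t - 1 < 1 - 1 / 2 ^ Suc k" for k
      unfolding P_def by (simp add: field_simps)
    let ?l = "LEAST k. P (Suc k)"
    have arg: "2 ^ Suc (Suc ?l) * (t - (1 - 1 / 2 ^ Suc ?l)) = 2 ^ Suc ?l * ((2 * t - 1) - (1 - 1 / 2 ^ ?l))"
      by (simp add: field_simps)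
    have "infinite_join g x t = g (Suc ?l) (2 ^ Suc (Suc ?l) * (t - (1 - 1 / 2 ^ Suc ?l)))"
      using 3 L unfolding infinite_join_def Let_def P_def by simp
    also have "\<dots> = infinite_join (\<lambda>k. g (Suc k)) x (2 * t - 1)"
      unfolding arg using 3 PS unfolding infinite_join_def Let_def by simp
    finally show ?thesis using 3 by (simp add: joinpaths_def)
  next
    case 4
    then show ?thesis by (simp add: joinpaths_def)
  qed
qed

lemma infinite_join_in:
  fixes x :: 'a
  assumes "\<And>k t. t \<in> {0..1} \<Longrightarrow> g k t \<in> B" "x \<in> B" "t \<in> {0..1}"
  shows "infinite_join g x t \<in> B"
proof (cases "t = 1")
  case False
  then have t: "0 \<le> t" "t < 1" using assms(3) by auto
  obtain k where k: "\<And>g (x::'a). infinite_join g x t = g k (2 ^ Suc k * (t - (1 - 1 / 2 ^ k)))"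
    "2 ^ Suc k * (t - (1 - 1 / 2 ^ k)) \<in> {0..1::real}"
    using infinite_join_piece[OF t] by blast
  show ?thesis unfolding k(1) by (rule assms(1)[OF k(2)])
qed (use assms in simp)

text \<open>For a fixed time, the value of the concatenation is therefore a locally constant
  function of the binary sequence selecting the loops.\<close>

lemma infinite_join_finite_dependence:
  fixes x :: 'a
  assumes "t \<in> {0..1}"
  obtains k where "\<And>g h. g k = h k \<Longrightarrow> infinite_join g x t = infinite_join h x t"
proof (cases "t = 1")
  case False
  then have t: "0 \<le> t" "t < 1" using assms by auto
  obtain k where k: "\<And>g (x::'a). infinite_join g x t = g k (2 ^ Suc k * (t - (1 - 1 / 2 ^ k)))"
    "2 ^ Suc k * (t - (1 - 1 / 2 ^ k)) \<in> {0..1::real}"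
    using infinite_join_piece[OF t] by blast
  show ?thesis
  proof (rule that[of k])
    fix g h :: "nat \<Rightarrow> real \<Rightarrow> 'a" assume "g k = h k"
    then show "infinite_join g x t = infinite_join h x t" unfolding k(1)[of g x] k(1)[of h x] by simp
  qed
qed (use that in simp)

text \<open>The truncations whose uniform limit is the infinite concatenation; after
  \<open>n\<close> loops they rest at \<open>x\<close>.\<close>

fun finite_join :: "nat \<Rightarrow> (nat \<Rightarrow> real \<Rightarrow> 'a::topological_space) \<Rightarrow> 'a \<Rightarrow> real \<Rightarrow> 'a" where
  "finite_join 0 g x = (\<lambda>_. x)"
| "finite_join (Suc n) g x = g 0 +++ finite_join n (\<lambda>k. g (Suc k)) x"

lemma finite_join_loop:
  assumes "\<And>k. path (g k)" "\<And>k. g k 0 = x" "\<And>k. g k 1 = x"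
  shows "path (finite_join n g x) \<and> finite_join n g x 0 = x \<and> finite_join n g x 1 = x"
  using assms
proof (induction n arbitrary: g)
  case 0
  then show ?case by (simp add: path_def)
next
  case (Suc n)
  have "path (finite_join n (\<lambda>k. g (Suc k)) x) \<and> finite_join n (\<lambda>k. g (Suc k)) x 0 = x
      \<and> finite_join n (\<lambda>k. g (Suc k)) x 1 = x"
    by (rule Suc.IH) (use Suc.prems in auto)
  then show ?case using Suc.prems
    by (auto intro!: path_join_imp simp: pathstart_def pathfinish_def) (simp_all add: joinpaths_def)
qed

lemma dist_finite_join:
  fixes x :: "'a::metric_space"
  assumes "\<And>k. g k 0 = x" "\<And>k. g k 1 = x" "\<And>k t. t \<in> {0..1} \<Longrightarrow> dist x (g k t) \<le> r k"
    and r: "antimono r" and t: "t \<in> {0..1}"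
  shows "dist (finite_join n g x t) (infinite_join g x t) \<le> r n"
  using assms
proof (induction n arbitrary: g r t)
  case 0
  have "dist x (g k t) \<le> r 0" if "t \<in> {0..1}" for k t
    using 0(3)[OF that, of k] antimonoD[OF 0(4), of 0 k] by simp
  moreover have "0 \<le> r 0" by (rule order_trans[OF zero_le_dist 0(3)[of 0 0]]) simp
  ultimately have "infinite_join g x t \<in> cball x (r 0)"
    using 0(5) by (intro infinite_join_in) auto
  then show ?case by simp
next
  case (Suc n)
  have IH: "dist (finite_join n (\<lambda>k. g (Suc k)) x s) (infinite_join (\<lambda>k. g (Suc k)) x s) \<le> r (Suc n)"
    if "s \<in> {0..1}" for s
    by (rule Suc.IH) (use Suc.prems that in \<open>auto simp: antimono_def\<close>)
  have "0 \<le> r (Suc n)" by (rule order_trans[OF zero_le_dist Suc.prems(3)[of 0 "Suc n"]]) simp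
  then show ?case
    unfolding infinite_join_eq_joinpaths[OF Suc.prems(1,2,5)]
    using IH[of "2 * t - 1"] Suc.prems(5) by (auto simp: joinpaths_def)
qed

text \<open>The truncations are continuous and converge uniformly with error at most
  \<open>r n\<close>. This gives continuity also at time 1, where the slots accumulate.\<close>

lemma connects_infinite_join:
  fixes x :: "'a::metric_space"
  assumes g: "\<And>k. connects (S \<inter> cball x (r k)) x x (g k)" and r: "antimono r" "r \<longlonglongrightarrow> 0"
  shows "connects S x x (infinite_join g x)"
proof -
  have g': "path (g k)" "g k 0 = x" "g k 1 = x" "\<And>t. t \<in> {0..1} \<Longrightarrow> g k t \<in> S \<inter> cball x (r k)" for k
    using g[of k] by (auto simp: connects_def path_image_def pathstart_def pathfinish_def image_subset_iff)
  have dist: "dist (finite_join n g x t) (infinite_join g x t) \<le> r n" if "t \<in> {0..1}" for n t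
    by (rule dist_finite_join) (use g' r that in auto)
  have "path (infinite_join g x)"
    unfolding path_def
  proof (rule uniform_limit_theorem[where F = sequentially and f = "\<lambda>n. finite_join n g x"])
    show "\<forall>\<^sub>F n in sequentially. continuous_on {0..1} (finite_join n g x)"
      using finite_join_loop[of g x] g' by (simp add: path_def)
    show "uniform_limit {0..1} (\<lambda>n. finite_join n g x) (infinite_join g x) sequentially"
      unfolding uniform_limit_iff
    proof (intro allI impI)
      fix e :: real assume "e > 0"
      with r(2) have "\<forall>\<^sub>F n in sequentially. r n < e" by (rule order_tendstoD)
      then show "\<forall>\<^sub>F n in sequentially. \<forall>t\<in>{0..1}. dist (finite_join n g x t) (infinite_join g x t) < e"
        by eventually_elim (use dist in \<open>meson le_less_trans\<close>)
    qed
  qed simp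
  moreover have "infinite_join g x t \<in> S" if "t \<in> {0..1}" for t
    using g' that by (intro infinite_join_in) (auto, metis g'(2,4) IntD1 atLeastAtMost_iff order_refl zero_le_one)
  moreover have "infinite_join g x 0 = x"
    using infinite_join_eq_joinpaths[of g x 0] g' by (simp add: joinpaths_def)
  ultimately show ?thesis by (auto simp: connects_def path_image_def pathstart_def pathfinish_def)
qed

lemma torsion_boundary_infinite_join:
  fixes S :: "'a::real_normed_vector set"
  assumes g: "\<And>k. connects (S \<inter> cball x (r k)) x x (g k)" and r: "antimono r" "r \<longlonglongrightarrow> 0"
  shows "torsion_boundary (top_of_set S)
    (path_chain (infinite_join g x) - path_chain (g 0) - path_chain (infinite_join (\<lambda>k. g (Suc k)) x))"
proof -
  have "path_simplex (infinite_join g x) = path_simplex (g 0 +++ infinite_join (\<lambda>k. g (Suc k)) x)"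
    unfolding path_simplex_eq_iff using infinite_join_eq_joinpaths[of g x] g
    by (auto simp: connects_def pathstart_def pathfinish_def)
  moreover have "connects S x x (infinite_join (\<lambda>k. g (Suc k)) x)"
    by (rule connects_infinite_join[of S x "\<lambda>k. r (Suc k)"])
      (use g r in \<open>auto simp: antimono_def LIMSEQ_Suc\<close>)
  moreover have "connects S x x (g 0)" using g connects_subset by blast
  ultimately show ?thesis using torsion_boundary_joinpaths[of S x x "g 0" x] by simp
qed

text \<open>Peel off loops one at a time until place \<open>n\<close> has been passed. The remaining
  tails are the same path and cancel, so only finitely many homologies are used.\<close>

lemma torsion_boundary_infinite_join_update:
  fixes S :: "'a::real_normed_vector set"
  assumes g: "\<And>k. connects (S \<inter> cball x (r k)) x x (g k)"
    and h: "\<And>k. connects (S \<inter> cball x (r k)) x x (h k)"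
    and r: "antimono r" "r \<longlonglongrightarrow> 0" and gh: "\<And>k. k \<noteq> n \<Longrightarrow> g k = h k"
  shows "torsion_boundary (top_of_set S)
    (path_chain (infinite_join g x) - path_chain (infinite_join h x) - (path_chain (g n) - path_chain (h n)))"
  using assms
proof (induction n arbitrary: g h r)
  case 0
  have eq: "(\<lambda>k. g (Suc k)) = (\<lambda>k. h (Suc k))" using 0(5) by auto
  show ?case
    using torsion_boundary_diff[OF torsion_boundary_infinite_join[OF 0(1,3,4)] torsion_boundary_infinite_join[OF 0(2,3,4)]]
    unfolding eq by (simp add: algebra_simps)
next
  case (Suc n)
  have g0: "g 0 = h 0" using Suc.prems(5) by auto
  have "torsion_boundary (top_of_set S)
    (path_chain (infinite_join (\<lambda>k. g (Suc k)) x) - path_chain (infinite_join (\<lambda>k. h (Suc k)) x)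
      - (path_chain (g (Suc n)) - path_chain (h (Suc n))))"
    by (rule Suc.IH[of "\<lambda>k. r (Suc k)"]) (use Suc.prems in \<open>auto simp: antimono_def LIMSEQ_Suc\<close>)
  from torsion_boundary_add[OF this torsion_boundary_diff[OF torsion_boundary_infinite_join[OF Suc.prems(1,3,4)]
        torsion_boundary_infinite_join[OF Suc.prems(2-4)]]]
  show ?case unfolding g0 by (simp add: algebra_simps)
qed

subsection \<open>Torsion homologies form a Souslin set\<close>

text \<open>Tychonoff's theorem. In the application the indices include the points of a triangle, an
  uncountable set, so a filter takes the place of a convergent subsequence.\<close>

lemma compact_pointwise_cluster_filter:
  fixes \<sigma> :: "nat \<Rightarrow> 'i \<Rightarrow> 'a::topological_space"
  assumes S: "compact S" and \<sigma>: "\<And>n i. \<sigma> n i \<in> S"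
  obtains F \<tau> where "F \<noteq> bot" "F \<le> sequentially" "\<And>i. \<tau> i \<in> S" "\<And>i. ((\<lambda>n. \<sigma> n i) \<longlongrightarrow> \<tau> i) F"
proof -
  define K where "K = (PiE UNIV (\<lambda>_. S) :: ('i \<Rightarrow> 'a) set)"
  have "compactin (product_topology (\<lambda>_. euclidean) UNIV) K"
    unfolding K_def compactin_PiE using S by simp
  then have "compact K" by (simp add: euclidean_product_topology)
  moreover have "filtermap \<sigma> sequentially \<noteq> bot" by (simp add: filtermap_bot_iff)
  moreover have "eventually (\<lambda>h. h \<in> K) (filtermap \<sigma> sequentially)"
    using \<sigma> by (simp add: eventually_filtermap K_def PiE_def Pi_def)
  ultimately obtain h where h: "h \<in> K" "inf (nhds h) (filtermap \<sigma> sequentially) \<noteq> bot"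
    unfolding compact_filter by blast
  \<comment> \<open>The neighbourhoods of the cluster point pulled back to the indices; that
    \<open>F\<close> is proper is the cluster property.\<close>
  define F where "F = inf sequentially (filtercomap \<sigma> (nhds h))"
  have "F \<noteq> bot"
  proof
    assume "F = bot"
    then have "eventually (\<lambda>_. False) F" by simp
    then obtain P Q where PQ: "eventually P sequentially" "eventually Q (filtercomap \<sigma> (nhds h))" "\<And>n. P n \<Longrightarrow> Q n \<Longrightarrow> False"
      unfolding F_def eventually_inf by blast
    then obtain R where R: "eventually R (nhds h)" "\<And>n. R (\<sigma> n) \<Longrightarrow> Q n"
      unfolding eventually_filtercomap by blast
    have "eventually (\<lambda>g. \<not> R g) (filtermap \<sigma> sequentially)"
      unfolding eventually_filtermap using PQ(1) by eventually_elim (use PQ(3) R(2) in blast)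
    then have "eventually (\<lambda>_. False) (inf (nhds h) (filtermap \<sigma> sequentially))"
      unfolding eventually_inf using R(1) by blast
    then show False using h(2) by (simp add: trivial_limit_def)
  qed
  moreover have "((\<lambda>n. \<sigma> n i) \<longlongrightarrow> h i) F" for i
  proof -
    have "(\<sigma> \<longlongrightarrow> h) F"
      unfolding F_def filterlim_def
      by (rule order_trans[OF filtermap_mono[OF inf_le2] filtermap_filtercomap])
    then have "eventually (\<lambda>n. \<sigma> n \<in> (\<lambda>g. g i) -` U) F" if "open U" "h i \<in> U" for U
      using that by (intro topological_tendstoD[of \<sigma> h] open_vimage continuous_on_product_coordinates) auto
    then show ?thesis by (intro topological_tendstoI) auto
  qed
  ultimately show ?thesis using that[of F h] h(1) by (auto simp: F_def K_def PiE_def Pi_def)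
qed

text \<open>Far enough along the filter, paths that coincide have limits that coincide, so that
  sending each path to its limit is well defined and maps the given relation to the relation between the limits.\<close>

lemma path_chain_relation_limit:
  fixes P :: "nat \<Rightarrow> 'k \<Rightarrow> real \<Rightarrow> 'a::t2_space"
  assumes J: "finite J" and F: "F \<noteq> bot"
    and lim: "\<And>k t. k \<in> J \<Longrightarrow> t \<in> {0..1} \<Longrightarrow> ((\<lambda>n. P n k t) \<longlongrightarrow> Q k t) F"
    and rel: "eventually (\<lambda>n. (\<Sum>k\<in>J. frag_cmul (c k) (path_chain (P n k))) = 0) F"
  shows "(\<Sum>k\<in>J. frag_cmul (c k) (path_chain (Q k))) = 0"
proof -
  have "eventually (\<lambda>n. path_simplex (P n k) = path_simplex (P n l) \<longrightarrow> path_simplex (Q k) = path_simplex (Q l)) F"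
    if kl: "k \<in> J" "l \<in> J" for k l
  proof (cases "path_simplex (Q k) = path_simplex (Q l)")
    case False
    then obtain t where t: "t \<in> {0..1}" "Q k t \<noteq> Q l t" by (auto simp: path_simplex_eq_iff)
    then obtain U V where UV: "open U" "open V" "Q k t \<in> U" "Q l t \<in> V" "U \<inter> V = {}"
      using hausdorff by metis
    have "eventually (\<lambda>n. P n k t \<in> U) F" "eventually (\<lambda>n. P n l t \<in> V) F"
      using lim[OF kl(1) t(1)] lim[OF kl(2) t(1)] UV by (auto intro: topological_tendstoD)
    then show ?thesis
      by eventually_elim (use UV(5) t(1) in \<open>auto simp: path_simplex_eq_iff\<close>)
  qed simp
  then have "eventually (\<lambda>n. \<forall>k\<in>J. \<forall>l\<in>J. path_simplex (P n k) = path_simplex (P n l) \<longrightarrow>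
      path_simplex (Q k) = path_simplex (Q l)) F"
    using J by (simp add: eventually_ball_finite_distrib)
  then have "eventually (\<lambda>n. (\<Sum>k\<in>J. frag_cmul (c k) (path_chain (P n k))) = 0 \<and>
      (\<forall>k\<in>J. \<forall>l\<in>J. path_simplex (P n k) = path_simplex (P n l) \<longrightarrow> path_simplex (Q k) = path_simplex (Q l))) F"
    using rel by eventually_elim blast
  then obtain n where n: "(\<Sum>k\<in>J. frag_cmul (c k) (path_chain (P n k))) = 0"
    "\<And>k l. k \<in> J \<Longrightarrow> l \<in> J \<Longrightarrow> path_simplex (P n k) = path_simplex (P n l) \<Longrightarrow> path_simplex (Q k) = path_simplex (Q l)"
    using eventually_happens'[OF F] by blast
  define h where "h f = path_simplex (Q (SOME k. k \<in> J \<and> path_simplex (P n k) = f))" for f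
  have h: "h (path_simplex (P n k)) = path_simplex (Q k)" if "k \<in> J" for k
  proof -
    have "\<exists>l. l \<in> J \<and> path_simplex (P n l) = path_simplex (P n k)" using that by blast
    from someI_ex[OF this] show ?thesis unfolding h_def using n(2) that by blast
  qed
  have "0 = frag_extend (\<lambda>f. frag_of (h f)) (\<Sum>k\<in>J. frag_cmul (c k) (path_chain (P n k)))"
    unfolding n(1) by simp
  also have "\<dots> = (\<Sum>k\<in>J. frag_cmul (c k) (path_chain (Q k)))"
    using J h by (simp add: frag_extend_sum frag_extend_cmul o_def)
  finally show ?thesis by simp
qed

lemma frag_cmul_diff_distrib2: "frag_cmul k (a - b) = frag_cmul k a - frag_cmul k b"
  by (rule poly_mapping_eqI) (simp add: lookup_minus right_diff_distrib)

definition tri_edge :: "nat \<Rightarrow> real \<Rightarrow> real \<times> real" where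
  "tri_edge e t = (if e = 0 then (1 - t, t) else if e = 1 then (0, t) else (t, 0))"

definition edge_sign :: "nat \<Rightarrow> int" where
  "edge_sign e = (if e = 1 then -1 else 1)"

lemma tri_edge_in: "t \<in> {0..1} \<Longrightarrow> tri_edge e t \<in> tri"
  by (auto simp: tri_edge_def tri_def)

lemma tri_boundary_sum_edges:
  "tri_boundary \<tau> = (\<Sum>e<3. frag_cmul (edge_sign e) (path_chain (\<tau> \<circ> tri_edge e)))"
  by (simp add: tri_boundary_def numeral_3_eq_3 edge_sign_def tri_edge_def o_def)

text \<open>Separates the countable data of a 2-chain, its list of coefficients, from its simplices,
  which carry the topology. Different indices may hold the same simplex, so the form survives limits
  in which simplices merge.\<close>

lemma singular_boundary_2_iff:
  "singular_relboundary 1 (top_of_set S) {} c \<longleftrightarrow>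
    (\<exists>a :: int list. \<exists>\<tau>. (\<forall>i<length a. continuous_on tri (\<tau> i) \<and> \<tau> i ` tri \<subseteq> S) \<and>
       c = (\<Sum>i<length a. frag_cmul (a ! i) (tri_boundary (\<tau> i))))"
proof
  assume "singular_relboundary 1 (top_of_set S) {} c"
  then obtain d where d: "singular_chain 2 (top_of_set S) d" "chain_boundary 2 d = c"
    by (auto simp: singular_boundary numeral_2_eq_2)
  obtain ks where ks: "set ks = Poly_Mapping.keys d" "distinct ks"
    using finite_distinct_list[OF finite_keys] by metis
  have "\<forall>i<length ks. \<exists>\<tau>. continuous_on tri \<tau> \<and> \<tau> ` tri \<subseteq> S \<and> ks ! i = tri_simplex \<tau>"
  proof (intro allI impI)
    fix i assume "i < length ks"
    then have "singular_simplex 2 (top_of_set S) (ks ! i)"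
      using d(1) ks(1) nth_mem unfolding singular_chain_def by blast
    then show "\<exists>\<tau>. continuous_on tri \<tau> \<and> \<tau> ` tri \<subseteq> S \<and> ks ! i = tri_simplex \<tau>"
      using singular_2_simplex_cases by metis
  qed
  then obtain \<tau> where \<tau>: "\<And>i. i < length ks \<Longrightarrow> continuous_on tri (\<tau> i) \<and> \<tau> i ` tri \<subseteq> S \<and> ks ! i = tri_simplex (\<tau> i)"
    by metis
  have "d = (\<Sum>k\<in>set ks. frag_cmul (poly_mapping.lookup d k) (frag_of k))"
    unfolding ks(1) using frag_expansion[of d] unfolding frag_extend_def .
  also have "\<dots> = (\<Sum>i<length ks. frag_cmul (poly_mapping.lookup d (ks ! i)) (frag_of (ks ! i)))"
    by (rule sum.reindex_bij_betw[OF bij_betw_nth, symmetric]) (use ks in auto)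
  finally have d': "d = (\<Sum>i<length ks. frag_cmul (poly_mapping.lookup d (ks ! i)) (frag_of (tri_simplex (\<tau> i))))"
    using \<tau> by simp
  have "c = (\<Sum>i<length ks. frag_cmul (poly_mapping.lookup d (ks ! i)) (tri_boundary (\<tau> i)))"
    unfolding d(2)[symmetric]
    by (subst d') (simp add: chain_boundary_sum chain_boundary_cmul chain_boundary_tri_simplex)
  then show "\<exists>a :: int list. \<exists>\<tau>. (\<forall>i<length a. continuous_on tri (\<tau> i) \<and> \<tau> i ` tri \<subseteq> S) \<and>
       c = (\<Sum>i<length a. frag_cmul (a ! i) (tri_boundary (\<tau> i)))"
    using \<tau> by (intro exI[of _ "map (poly_mapping.lookup d) ks"] exI[of _ \<tau>]) simp
next
  assume "\<exists>a :: int list. \<exists>\<tau>. (\<forall>i<length a. continuous_on tri (\<tau> i) \<and> \<tau> i ` tri \<subseteq> S) \<and>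
       c = (\<Sum>i<length a. frag_cmul (a ! i) (tri_boundary (\<tau> i)))"
  then obtain a \<tau> where a: "\<And>i. i < length (a :: int list) \<Longrightarrow> continuous_on tri (\<tau> i) \<and> \<tau> i ` tri \<subseteq> S"
    and c: "c = (\<Sum>i<length a. frag_cmul (a ! i) (tri_boundary (\<tau> i)))" by blast
  have bd: "singular_relboundary 1 (top_of_set S) {} (tri_boundary (\<tau> i))" if "i < length a" for i
    using a[OF that] singular_boundary_tri_boundary by blast
  have "k \<le> length a \<Longrightarrow> singular_relboundary 1 (top_of_set S) {} (\<Sum>i<k. frag_cmul (a ! i) (tri_boundary (\<tau> i)))" for k
    by (induction k) (use bd in \<open>auto intro!: singular_relboundary_add singular_relboundary_cmul\<close>)
  then show "singular_relboundary 1 (top_of_set S) {} c" unfolding c by blast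
qed

definition is_filling :: "'a::metric_space set \<Rightarrow> ((nat \<Rightarrow> bool) \<Rightarrow> real \<Rightarrow> 'a) \<Rightarrow> (nat \<Rightarrow> bool \<times> bool) \<Rightarrow>
    nat \<Rightarrow> int list \<Rightarrow> (nat \<Rightarrow> real \<times> real \<Rightarrow> 'a) \<Rightarrow> bool" where
  "is_filling S W z N a \<tau> \<longleftrightarrow> 0 < N \<and> (\<forall>i<length a. continuous_on tri (\<tau> i) \<and> \<tau> i ` tri \<subseteq> S) \<and>
     frag_cmul (int N) (path_chain (W (fst \<circ> z)) - path_chain (W (snd \<circ> z))) =
       (\<Sum>i<length a. frag_cmul (a ! i) (tri_boundary (\<tau> i)))"

text \<open>The first entry of a sequence encodes the coefficients of the 2-chain, the later ones a modulus of
  continuity of its simplices.\<close>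

definition obeys :: "nat list \<Rightarrow> nat \<Rightarrow> int list \<Rightarrow> (nat \<Rightarrow> real \<times> real \<Rightarrow> 'a::metric_space) \<Rightarrow> bool" where
  "obeys s N a \<tau> \<longleftrightarrow> (s \<noteq> [] \<longrightarrow> s ! 0 = to_nat (N, a)) \<and>
     (\<forall>j. 0 < j \<and> j < length s \<longrightarrow> (\<forall>i<length a. \<forall>u\<in>tri. \<forall>v\<in>tri.
        dist u v < 1 / real (Suc (s ! j)) \<longrightarrow> dist (\<tau> i u) (\<tau> i v) \<le> 1 / real j))"

definition filling_scheme :: "'a::metric_space set \<Rightarrow> ((nat \<Rightarrow> bool) \<Rightarrow> real \<Rightarrow> 'a) \<Rightarrow> nat list \<Rightarrow> (nat \<Rightarrow> bool \<times> bool) set" where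
  "filling_scheme S W s = {z. \<exists>N a \<tau>. is_filling S W z N a \<tau> \<and> obeys s N a \<tau>}"

lemma compact_tri: "compact tri"
proof -
  have "tri = {0..1} \<times> {0..1} \<inter> {x. fst x + snd x \<le> 1}" by (auto simp: tri_def)
  moreover have "closed {x :: real \<times> real. fst x + snd x \<le> 1}"
    by (intro closed_Collect_le continuous_intros)
  ultimately show ?thesis by (metis compact_Icc compact_Int_closed compact_Times)
qed

lemma filling_scheme_Nil:
  "filling_scheme S W [] = {z. torsion_boundary (top_of_set S) (path_chain (W (fst \<circ> z)) - path_chain (W (snd \<circ> z)))}"
  unfolding filling_scheme_def is_filling_def obeys_def torsion_boundary_def singular_boundary_2_iff
  by auto

text \<open>Finitely many maps on the compact triangle have a common modulus, which supplies the
  next entry; after the empty sequence the next entry is the code of the coefficients.\<close>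

lemma filling_scheme_extend: "filling_scheme S W s \<subseteq> (\<Union>k. filling_scheme S W (s @ [k]))"
proof
  fix z assume "z \<in> filling_scheme S W s"
  then obtain N a \<tau> where f: "is_filling S W z N a \<tau>" and o: "obeys s N a \<tau>"
    by (auto simp: filling_scheme_def)
  have "\<exists>k. obeys (s @ [k]) N a \<tau>"
  proof (cases "s = []")
    case True
    then show ?thesis by (auto simp: obeys_def)
  next
    case False
    have "\<exists>\<delta>>0. \<forall>u\<in>tri. \<forall>v\<in>tri. dist u v < \<delta> \<longrightarrow> dist (\<tau> i u) (\<tau> i v) \<le> 1 / real (length s)" if "i < length a" for i
    proof -
      have "uniformly_continuous_on tri (\<tau> i)"
        using f that compact_tri by (intro compact_uniformly_continuous) (auto simp: is_filling_def)
      moreover have "0 < 1 / real (length s)" using False by simp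
      ultimately obtain \<delta> where "\<delta> > 0" "\<And>u v. u \<in> tri \<Longrightarrow> v \<in> tri \<Longrightarrow> dist v u < \<delta> \<Longrightarrow> dist (\<tau> i v) (\<tau> i u) < 1 / real (length s)"
        unfolding uniformly_continuous_on_def by meson
      then show ?thesis by (meson less_imp_le)
    qed
    then obtain \<delta> where \<delta>: "\<And>i. i < length a \<Longrightarrow> \<delta> i > 0"
      "\<And>i u v. i < length a \<Longrightarrow> u \<in> tri \<Longrightarrow> v \<in> tri \<Longrightarrow> dist u v < \<delta> i \<Longrightarrow> dist (\<tau> i u) (\<tau> i v) \<le> 1 / real (length s)"
      by metis
    \<comment> \<open>Inserting 1 keeps the minimum defined when the list \<open>a\<close> is
      empty.\<close>
    define m where "m = Min (insert 1 (\<delta> ` {..<length a}))"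
    have "m > 0" unfolding m_def using \<delta>(1) by (subst Min_gr_iff) auto
    then obtain k where k: "1 / real (Suc k) < m" using nat_approx_posE by blast
    have "m \<le> \<delta> i" if "i < length a" for i unfolding m_def using that by (intro Min_le) auto
    then have "dist (\<tau> i u) (\<tau> i v) \<le> 1 / real (length s)"
      if "i < length a" "u \<in> tri" "v \<in> tri" "dist u v < 1 / real (Suc k)" for i u v
      using \<delta>(2)[OF that(1-3)] k that by fastforce
    then have "obeys (s @ [k]) N a \<tau>"
      using o False unfolding obeys_def by (auto simp: nth_append less_Suc_eq)
    then show ?thesis by blast
  qed
  then show "z \<in> (\<Union>k. filling_scheme S W (s @ [k]))" using f by (auto simp: filling_scheme_def)
qed

text \<open>Fillings found along one branch share their coefficients and moduli. The bounds in
  \<open>obeys\<close> are non-strict, so they pass to a pointwise cluster point and make it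
  continuous.\<close>

lemma filling_scheme_limit:
  fixes S :: "'a::metric_space set"
  assumes S: "compact S" "x0 \<in> S"
    and W: "\<And>\<alpha> t. t \<in> {0..1} \<Longrightarrow> \<exists>n. \<forall>\<beta>\<in>cyl \<alpha> n. W \<beta> t = W \<alpha> t"
    and z: "\<And>n. filling_scheme S W (map \<omega> [0..<n]) \<inter> cyl z n \<noteq> {}"
  shows "z \<in> filling_scheme S W []"
proof -
  have "\<forall>n. \<exists>z' N a \<tau>. z' \<in> cyl z n \<and> is_filling S W z' N a \<tau> \<and> obeys (map \<omega> [0..<n]) N a \<tau>"
    using z unfolding filling_scheme_def by blast
  then obtain zs Ns as \<tau>s where zs: "\<And>n. zs n \<in> cyl z n" and f: "\<And>n. is_filling S W (zs n) (Ns n) (as n) (\<tau>s n)"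
    and o: "\<And>n. obeys (map \<omega> [0..<n]) (Ns n) (as n) (\<tau>s n)"
    by metis
  \<comment> \<open>The empty prefix fixes no code, so the coefficients are read off at index 1;
    from there on the entry \<open>\<omega> 0\<close> keeps them the same.\<close>
  define N a where "N = Ns 1" and "a = as 1"
  have Na: "Ns n = N \<and> as n = a" if "n > 0" for n
  proof -
    have "to_nat (Ns n, as n) = \<omega> 0" if "n > 0" for n
      using o[of n] that unfolding obeys_def by auto
    from this[of n] this[of 1] that have "to_nat (Ns n, as n) = to_nat (Ns 1, as 1)" by simp
    then show ?thesis unfolding N_def a_def by (metis inj_onD inj_to_nat UNIV_I prod.inject)
  qed
  \<comment> \<open>Padding with \<open>x0\<close> puts every value into the compact set. Index 0 is
    padded as well because its coefficient list may differ from \<open>a\<close>.\<close>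
  define \<sigma> where "\<sigma> n p = (if fst p < length a \<and> snd p \<in> tri \<and> n > 0 then \<tau>s n (fst p) (snd p) else x0)" for n p
  have "\<sigma> n p \<in> S" for n p
    using f[of n] Na[of n] S(2) unfolding \<sigma>_def is_filling_def by auto
  then obtain F \<tau>' where F: "F \<noteq> bot" "F \<le> sequentially" and \<tau>': "\<And>p. \<tau>' p \<in> S" "\<And>p. ((\<lambda>n. \<sigma> n p) \<longlongrightarrow> \<tau>' p) F"
    using compact_pointwise_cluster_filter[OF S(1), of \<sigma>] by metis
  define \<tau> where "\<tau> i u = \<tau>' (i, u)" for i u
  have ev: "eventually (\<lambda>n. n > k) F" for k
    using F(2) eventually_gt_at_top[of k] filter_leD by blast
  have lim\<tau>: "((\<lambda>n. \<tau>s n i u) \<longlongrightarrow> \<tau> i u) F" if "i < length a" "u \<in> tri" for i u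
  proof -
    have "eventually (\<lambda>n. \<sigma> n (i, u) = \<tau>s n i u) F"
      using ev[of 0] by eventually_elim (use that in \<open>simp add: \<sigma>_def\<close>)
    then show ?thesis using \<tau>'(2)[of "(i, u)"] unfolding \<tau>_def by (rule Lim_transform_eventually[rotated])
  qed
  have cont: "continuous_on tri (\<tau> i)" if i: "i < length a" for i
    unfolding continuous_on_iff
  proof (intro ballI allI impI)
    fix u and e :: real assume u: "u \<in> tri" and e: "0 < e"
    obtain j' where j': "1 / real (Suc j') < e" using nat_approx_posE[OF e] by blast
    \<comment> \<open>Entry 0 of the branch is the code and the moduli start at entry 1, hence a
      successor.\<close>
    define j where "j = Suc j'"
    have "dist (\<tau> i v) (\<tau> i u) < e" if v: "v \<in> tri" "dist v u < 1 / real (Suc (\<omega> j))" for v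
    proof -
      have "((\<lambda>n. dist (\<tau>s n i v) (\<tau>s n i u)) \<longlongrightarrow> dist (\<tau> i v) (\<tau> i u)) F"
        by (intro tendsto_dist lim\<tau> i u v)
      moreover have "eventually (\<lambda>n. dist (\<tau>s n i v) (\<tau>s n i u) \<le> 1 / real j) F"
        using ev[of j]
      proof eventually_elim
        case (elim n)
        then have "map \<omega> [0..<n] ! j = \<omega> j" "j > 0" "j < length (map \<omega> [0..<n])" "as n = a"
          using Na[of n] by (auto simp: j_def)
        then show ?case using o[of n] i u v unfolding obeys_def by metis
      qed
      ultimately have "dist (\<tau> i v) (\<tau> i u) \<le> 1 / real j" using F(1) by (rule tendsto_upperbound)
      then show ?thesis using j' by (simp add: j_def)
    qed
    then show "\<exists>d>0. \<forall>v\<in>tri. dist v u < d \<longrightarrow> dist (\<tau> i v) (\<tau> i u) < e"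
      by (intro exI[of _ "1 / real (Suc (\<omega> j))"]) simp
  qed
  \<comment> \<open>\<open>zs n\<close> agrees with \<open>z\<close> in the first \<open>n\<close>
    entries, so at each time the values along \<open>zs\<close> are eventually constant.\<close>
  have limW: "((\<lambda>n. W (pr \<circ> zs n) t) \<longlongrightarrow> W (pr \<circ> z) t) F" if t: "t \<in> {0..1}" for pr :: "bool \<times> bool \<Rightarrow> bool" and t
  proof -
    obtain k where k: "\<And>\<beta>. \<beta> \<in> cyl (pr \<circ> z) k \<Longrightarrow> W \<beta> t = W (pr \<circ> z) t" using W[OF t] by blast
    have "eventually (\<lambda>n. W (pr \<circ> z) t = W (pr \<circ> zs n) t) F"
      using ev[of k]
    proof eventually_elim
      case (elim n)
      then have "pr \<circ> zs n \<in> cyl (pr \<circ> z) k" using zs[of n] by (simp add: cyl_def)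
      then show ?case by (rule k[symmetric])
    qed
    then show ?thesis by (rule Lim_transform_eventually[OF tendsto_const])
  qed
  \<comment> \<open>The filling equation brought to one side: \<open>Inl\<close> indexes the two
    loops, \<open>Inr\<close> the three edges of each triangle. A single family is needed since
    loops may cancel against edges.\<close>
  define J where "J = {..<2::nat} <+> ({..<length a} \<times> {..<3::nat})"
  define path_of where "path_of z \<tau> k = (case k of Inl b \<Rightarrow> W ((if b = 0 then fst else snd) \<circ> z)
      | Inr (i, e) \<Rightarrow> \<tau> i \<circ> tri_edge e)" for z :: "nat \<Rightarrow> bool \<times> bool" and \<tau> and k :: "nat + nat \<times> nat"
  define c where "c k = (case k of Inl b \<Rightarrow> (if b = 0 then int N else - int N)
      | Inr (i, e) \<Rightarrow> - (a ! i * edge_sign e))" for k :: "nat + nat \<times> nat"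
  have sumJ: "(\<Sum>k\<in>J. frag_cmul (c k) (path_chain (path_of z \<tau> k))) =
      frag_cmul (int N) (path_chain (W (fst \<circ> z)) - path_chain (W (snd \<circ> z))) -
      (\<Sum>i<length a. frag_cmul (a ! i) (tri_boundary (\<tau> i)))" for z \<tau>
  proof -
    have "(\<Sum>k\<in>{..<2}. frag_cmul (c (Inl k)) (path_chain (path_of z \<tau> (Inl k)))) =
        frag_cmul (int N) (path_chain (W (fst \<circ> z)) - path_chain (W (snd \<circ> z)))"
      by (simp add: numeral_2_eq_2 c_def path_of_def frag_cmul_diff_distrib2 flip: minus_frag_cmul)
    moreover have "(\<Sum>k\<in>{..<length a} \<times> {..<3}. frag_cmul (c (Inr k)) (path_chain (path_of z \<tau> (Inr k)))) =
        - (\<Sum>i<length a. frag_cmul (a ! i) (tri_boundary (\<tau> i)))"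
      unfolding sum.cartesian_product' sum_negf[symmetric] tri_boundary_sum_edges
      by (simp add: c_def path_of_def frag_cmul_sum sum_negf[symmetric] o_def)
    ultimately show ?thesis unfolding J_def by (simp add: sum.Plus)
  qed
  have "(\<Sum>k\<in>J. frag_cmul (c k) (path_chain (path_of z \<tau> k))) = 0"
  proof (rule path_chain_relation_limit[OF _ F(1), where P = "\<lambda>n. path_of (zs n) (\<tau>s n)"])
    show "finite J" by (simp add: J_def)
    show "((\<lambda>n. path_of (zs n) (\<tau>s n) k t) \<longlongrightarrow> path_of z \<tau> k t) F" if "k \<in> J" "t \<in> {0..1}" for k t
    proof (cases k)
      case (Inl b)
      then show ?thesis using limW[OF that(2)] by (simp add: path_of_def)
    next
      case (Inr p)
      then obtain i e where "k = Inr (i, e)" "i < length a" using \<open>k \<in> J\<close> by (auto simp: J_def)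
      then show ?thesis using lim\<tau>[OF _ tri_edge_in[OF that(2)]] by (simp add: path_of_def)
    qed
    show "eventually (\<lambda>n. (\<Sum>k\<in>J. frag_cmul (c k) (path_chain (path_of (zs n) (\<tau>s n) k))) = 0) F"
      using ev[of 0]
    proof eventually_elim
      case (elim n)
      then show ?case unfolding sumJ using f[of n] Na[of n] unfolding is_filling_def by simp
    qed
  qed
  moreover have "N > 0" using f[of 1] by (simp add: is_filling_def N_def)
  ultimately have "is_filling S W z N a \<tau>"
    unfolding is_filling_def sumJ using cont \<tau>'(1) by (auto simp: \<tau>_def)
  then show ?thesis unfolding filling_scheme_def obeys_def by auto
qed

subsection \<open>Continuum many classes\<close>

text \<open>The base points of ever smaller non-torsion loops accumulate at some \<open>x\<close> by
  compactness. Conjugating by a short path from \<open>x\<close> moves the base point to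
  \<open>x\<close> without changing the homology class.\<close>

lemma shrinking_nontorsion_loops:
  fixes S :: "'a::real_normed_vector set"
  assumes S: "compact S" "locally_path_connected_space (top_of_set S)"
    and nt: "\<And>e. 0 < e \<Longrightarrow> \<not> small_loops_torsion S e"
  obtains x f where "x \<in> S" "\<And>k. connects (S \<inter> cball x (1 / real (Suc k))) x x (f k)"
    "\<And>k. \<not> torsion_boundary (top_of_set S) (path_chain (f k))"
proof -
  have "\<forall>n. \<exists>y p. y \<in> S \<and> connects (S \<inter> ball y (1 / real (Suc n))) y y p \<and> \<not> torsion_boundary (top_of_set S) (path_chain p)"
    using nt unfolding small_loops_torsion_def by (metis of_nat_0_less_iff zero_less_Suc zero_less_divide_1_iff)
  then obtain y p where y: "\<And>n. y n \<in> S" and p: "\<And>n. connects (S \<inter> ball (y n) (1 / real (Suc n))) (y n) (y n) (p n)"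
    and ptor: "\<And>n. \<not> torsion_boundary (top_of_set S) (path_chain (p n))"
    by metis
  obtain x s where x: "x \<in> S" "strict_mono s" "(y \<circ> s) \<longlonglongrightarrow> x"
    using S(1) y unfolding compact_eq_seq_compact_metric seq_compact_def by blast
  have "\<exists>f. connects (S \<inter> cball x (1 / real (Suc k))) x x f \<and> \<not> torsion_boundary (top_of_set S) (path_chain f)" for k
  proof -
    \<comment> \<open>Half of the target radius: the connecting path stays within \<open>e\<close>
      of \<open>x\<close>, and the loop within \<open>e\<close> of a base point at distance less
      than \<open>e\<close>.\<close>
    define e where "e = 1 / real (Suc k) / 2"
    have e: "e > 0" by (simp add: e_def)
    obtain d where d: "d > 0" "\<And>v w. v \<in> S \<Longrightarrow> w \<in> S \<Longrightarrow> dist v w < d \<Longrightarrow> \<exists>q. connects (S \<inter> ball v e) v w q"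
      using uniformly_locally_path_connected[OF S e] by blast
    have "eventually (\<lambda>n. dist ((y \<circ> s) n) x < min d e) sequentially"
      using d(1) e by (intro tendstoD[OF x(3)]) auto
    moreover have "eventually (\<lambda>n. 1 / real (Suc n) < e) sequentially"
      using LIMSEQ_Suc[OF lim_1_over_n] e by (rule order_tendstoD)
    ultimately have "eventually (\<lambda>n. dist ((y \<circ> s) n) x < min d e \<and> 1 / real (Suc n) < e) sequentially"
      by (rule eventually_conj)
    then obtain n where n: "dist (y (s n)) x < min d e" "1 / real (Suc n) < e"
      by (auto simp: eventually_sequentially)
    let ?y = "y (s n)"
    have sn: "1 / real (Suc (s n)) < e"
      using n(2) strict_mono_imp_increasing[OF x(2), of n]
      by (meson divide_left_mono le_less_trans mult_pos_pos of_nat_0_less_iff of_nat_le_iff Suc_le_mono zero_le_one zero_less_Suc)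
    obtain q where q: "connects (S \<inter> ball x e) x ?y q"
      using d(2)[OF x(1) y, of "s n"] n(1) by (auto simp: dist_commute)
    have ee: "e + e = 1 / real (Suc k)" unfolding e_def by (rule field_sum_of_halves)
    then have "e \<le> 1 / real (Suc k)" using e by linarith
    then have b1: "S \<inter> ball x e \<subseteq> S \<inter> cball x (1 / real (Suc k))" by auto
    have "ball ?y (1 / real (Suc (s n))) \<subseteq> cball x (1 / real (Suc k))"
    proof
      fix w assume "w \<in> ball ?y (1 / real (Suc (s n)))"
      then have "dist ?y w < e" "dist x ?y < e" using sn n(1) by (auto simp: dist_commute)
      then show "w \<in> cball x (1 / real (Suc k))"
        unfolding mem_cball using dist_triangle[of x w ?y] ee by linarith
    qed
    then have b2: "S \<inter> ball ?y (1 / real (Suc (s n))) \<subseteq> S \<inter> cball x (1 / real (Suc k))" by blast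
    let ?f = "(q +++ p (s n)) +++ reversepath q"
    note q' = connects_subset[OF q b1] and p' = connects_subset[OF p[of "s n"] b2]
    have f: "connects (S \<inter> cball x (1 / real (Suc k))) x x ?f"
      by (intro connects_joinpaths[OF connects_joinpaths[OF q' p']] connects_reversepath q')
    have qS: "connects S x ?y q" and pS: "connects S ?y ?y (p (s n))"
      using q p connects_subset by blast+
    have "\<not> torsion_boundary (top_of_set S) (path_chain ?f)"
    proof
      assume "torsion_boundary (top_of_set S) (path_chain ?f)"
      from torsion_boundary_diff[OF torsion_boundary_diff[OF this
            torsion_boundary_join_reversepath[OF connects_joinpaths[OF qS pS] qS]]
            torsion_boundary_joinpaths[OF qS pS]]
      have "torsion_boundary (top_of_set S) (path_chain (p (s n)))" by (simp add: algebra_simps)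
      then show False using ptor by blast
    qed
    then show ?thesis using f by blast
  qed
  then show ?thesis using that[OF x(1)] by metis
qed

lemma continuum_many_nonhomologous_loops:
  fixes S :: "'a::real_normed_vector set"
  assumes S: "compact S" "locally_path_connected_space (top_of_set S)"
    and nt: "\<And>e. 0 < e \<Longrightarrow> \<not> small_loops_torsion S e"
  obtains x and V :: "(nat \<Rightarrow> bool) \<Rightarrow> real \<Rightarrow> 'a" where "\<And>\<alpha>. connects S x x (V \<alpha>)"
    "\<And>\<alpha> \<beta>. \<alpha> \<noteq> \<beta> \<Longrightarrow> \<not> torsion_boundary (top_of_set S) (path_chain (V \<alpha>) - path_chain (V \<beta>))"
proof -
  let ?X = "top_of_set S" and ?r = "\<lambda>k. 1 / real (Suc k)"
  obtain x f where x: "x \<in> S" and f: "\<And>k. connects (S \<inter> cball x (?r k)) x x (f k)"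
    and ftor: "\<And>k. \<not> torsion_boundary ?X (path_chain (f k))"
    using shrinking_nontorsion_loops[OF S nt] by blast
  have r: "antimono ?r" "?r \<longlonglongrightarrow> 0"
    using LIMSEQ_Suc[OF lim_1_over_n] by (auto simp: antimono_def intro!: divide_left_mono)
  \<comment> \<open>An omitted loop becomes a pause, so the slot of loop \<open>k\<close> does not
    move with \<open>\<alpha>\<close>, and \<open>W \<alpha> t\<close> depends on at most one entry
    of \<open>\<alpha>\<close>.\<close>
  define g where "g \<alpha> k = (if \<alpha> k then f k else (\<lambda>_. x))" for \<alpha> :: "nat \<Rightarrow> bool" and k
  have g: "connects (S \<inter> cball x (?r k)) x x (g \<alpha> k)" for \<alpha> k
    using f[of k] x by (auto simp: g_def connects_def path_def path_image_def pathstart_def pathfinish_def)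
  define W where "W \<alpha> = infinite_join (g \<alpha>) x" for \<alpha>
  have W: "connects S x x (W \<alpha>)" for \<alpha>
    unfolding W_def by (rule connects_infinite_join[OF g r])
  have Wdep: "\<exists>n. \<forall>\<beta>\<in>cyl \<alpha> n. W \<beta> t = W \<alpha> t" if t: "t \<in> {0..1}" for \<alpha> t
  proof -
    obtain k where k: "\<And>h h'. h k = h' k \<Longrightarrow> infinite_join h x t = infinite_join h' x t"
      by (rule infinite_join_finite_dependence[OF t]) (rule that)
    have "W \<beta> t = W \<alpha> t" if "\<beta> \<in> cyl \<alpha> (Suc k)" for \<beta>
      unfolding W_def by (rule k) (use that in \<open>simp add: g_def cyl_def\<close>)
    then show ?thesis by blast
  qed
  define E where "E \<alpha> \<beta> \<longleftrightarrow> torsion_boundary ?X (path_chain (W \<alpha>) - path_chain (W \<beta>))" for \<alpha> \<beta>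
  have sym: "E \<beta> \<alpha>" if "E \<alpha> \<beta>" for \<alpha> \<beta>
    using torsion_boundary_minus[of ?X "path_chain (W \<alpha>) - path_chain (W \<beta>)"] that by (simp add: E_def)
  have trans: "E \<alpha> \<gamma>" if "E \<alpha> \<beta>" "E \<beta> \<gamma>" for \<alpha> \<beta> \<gamma>
    using torsion_boundary_add[OF that[unfolded E_def]] by (simp add: E_def)
  have const: "torsion_boundary ?X (path_chain (\<lambda>_. x))"
    by (intro singular_boundary_imp_torsion_boundary singular_boundary_const_path x)
  \<comment> \<open>Modulo torsion the two concatenations differ by \<open>f n\<close> minus a
    constant loop, and the constant loop is a boundary.\<close>
  have on_off: "\<not> E \<alpha> (\<alpha>(n := \<not> \<alpha> n))" if "\<alpha> n" for \<alpha> n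
  proof
    assume "E \<alpha> (\<alpha>(n := \<not> \<alpha> n))"
    moreover have "torsion_boundary ?X (path_chain (W \<alpha>) - path_chain (W (\<alpha>(n := \<not> \<alpha> n))) -
        (path_chain (g \<alpha> n) - path_chain (g (\<alpha>(n := \<not> \<alpha> n)) n)))"
      unfolding W_def by (rule torsion_boundary_infinite_join_update[OF g g r]) (simp add: g_def)
    ultimately have "torsion_boundary ?X (path_chain (g \<alpha> n) - path_chain (g (\<alpha>(n := \<not> \<alpha> n)) n))"
      unfolding E_def using torsion_boundary_diff by fastforce
    then have "torsion_boundary ?X (path_chain (f n) - path_chain (\<lambda>_. x))"
      using that by (simp add: g_def)
    from torsion_boundary_add[OF this const] show False using ftor by simp
  qed
  have flip: "\<not> E \<alpha> (\<alpha>(n := \<not> \<alpha> n))" for \<alpha> n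
  proof (cases "\<alpha> n")
    case False
    have "\<not> E (\<alpha>(n := \<not> \<alpha> n)) ((\<alpha>(n := \<not> \<alpha> n))(n := \<not> (\<alpha>(n := \<not> \<alpha> n)) n))"
      by (rule on_off) (use False in simp)
    then show ?thesis using sym by (auto simp: False fun_upd_idem)
  qed (rule on_off)
  have AE: "filling_scheme S W [] = {z. E (fst \<circ> z) (snd \<circ> z)}"
    unfolding filling_scheme_Nil E_def ..
  have "meager (filling_scheme S W [])"
    by (rule souslin_equivalence_meager[OF sym trans flip filling_scheme_extend filling_scheme_limit[OF S(1) x Wdep] AE])
  then obtain h :: "(nat \<Rightarrow> bool) \<Rightarrow> nat \<Rightarrow> bool" where "\<And>a b. a \<noteq> b \<Longrightarrow> \<not> E (h a) (h b)"
    using meager_relation_imp_inequivalent_family[of E] unfolding AE by blast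
  then show ?thesis using that[of x "\<lambda>a. W (h a)"] W by (simp add: E_def)
qed

section \<open>Cardinality of the group when small loops are not torsion\<close>

lemma compact_countable_net:
  fixes S :: "'a::metric_space set"
  assumes "compact S"
  obtains D where "countable D" "\<And>e x. 0 < e \<Longrightarrow> x \<in> S \<Longrightarrow> \<exists>q\<in>D. dist x q < e"
proof -
  have "\<exists>Q. finite Q \<and> S \<subseteq> (\<Union>q\<in>Q. ball q (1 / real (Suc n)))" for n
    using assms unfolding compact_eq_totally_bounded by simp
  then obtain Q where Q: "\<And>n. finite (Q n)" "\<And>n. S \<subseteq> (\<Union>q\<in>Q n. ball q (1 / real (Suc n)))"
    by metis
  show ?thesis
  proof (rule that[of "\<Union>n. Q n"])
    show "countable (\<Union>n. Q n)" using Q(1) by (simp add: countable_finite)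
    fix e :: real and x assume "0 < e" "x \<in> S"
    then obtain n where n: "1 / real (Suc n) < e" using nat_approx_posE by blast
    obtain q where "q \<in> Q n" "x \<in> ball q (1 / real (Suc n))" using Q(2)[of n] \<open>x \<in> S\<close> by blast
    then show "\<exists>q\<in>\<Union>n. Q n. dist x q < e" using n by (auto simp: dist_commute intro!: bexI[of _ q])
  qed
qed

text \<open>A path is determined by its values at rational times, and a value by the net points
  closer than \<open>1 / Suc n\<close> for each \<open>n\<close>. So a subset of a countable set
  encodes the path.\<close>

lemma path_simplices_lepoll:
  fixes S :: "'a::metric_space set"
  assumes S: "compact S"
  shows "singular_simplex_set 1 (top_of_set S) \<lesssim> (UNIV :: nat set set)"
proof -
  obtain D where D: "countable D" "\<And>e x. 0 < e \<Longrightarrow> x \<in> S \<Longrightarrow> \<exists>q\<in>D. dist x q < e"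
    using compact_countable_net[OF S] by blast
  define C where "C = (\<rat> :: real set) \<times> D \<times> (UNIV :: nat set)"
  have C: "countable C" unfolding C_def using D(1) countable_rat by (intro countable_SIGMA) auto
  define pth where "pth f = (SOME p. path p \<and> path_image p \<subseteq> S \<and> f = path_simplex p)" for f
  have pth: "path (pth f) \<and> path_image (pth f) \<subseteq> S \<and> f = path_simplex (pth f)"
    if "f \<in> singular_simplex_set 1 (top_of_set S)" for f
  proof -
    have "\<exists>p. path p \<and> path_image p \<subseteq> S \<and> f = path_simplex p"
      using that singular_1_simplex_cases by (metis mem_Collect_eq)
    from someI_ex[OF this] show ?thesis unfolding pth_def .
  qed
  \<comment> \<open>Constant continuation to the whole line, so that density of the rationals in the
    reals can be used directly.\<close>
  define ext where "ext f t = pth f (max 0 (min 1 t))" for f and t :: real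
  define code where "code f = {(t, q, n). (t, q, n) \<in> C \<and> dist (ext f t) q < 1 / real (Suc n)}" for f
  have "inj_on (\<lambda>f. to_nat_on C ` code f) (singular_simplex_set 1 (top_of_set S))"
  proof (rule inj_onI)
    fix f f' assume f: "f \<in> singular_simplex_set 1 (top_of_set S)" "f' \<in> singular_simplex_set 1 (top_of_set S)"
      and eq: "to_nat_on C ` code f = to_nat_on C ` code f'"
    have "code f \<subseteq> C" "code f' \<subseteq> C" by (auto simp: code_def)
    then have ceq: "code f = code f'" using eq inj_on_to_nat_on[OF C] by (simp add: inj_on_image_eq_iff)
    have cont: "continuous_on UNIV (ext k)" if "k \<in> singular_simplex_set 1 (top_of_set S)" for k
    proof -
      have "continuous_on {0..1} (pth k)" using pth[OF that] by (simp add: path_def)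
      then show ?thesis unfolding ext_def
        by (rule continuous_on_compose2) (auto intro!: continuous_intros)
    qed
    have inS: "ext k t \<in> S" if "k \<in> singular_simplex_set 1 (top_of_set S)" for k t
      using pth[OF that] unfolding ext_def path_image_def by (auto simp: image_subset_iff)
    have "ext f t = ext f' t" if t: "t \<in> \<rat>" for t
    proof (rule ccontr)
      assume "ext f t \<noteq> ext f' t"
      then have pos: "0 < dist (ext f t) (ext f' t) / 2" by simp
      then obtain n where n: "1 / real (Suc n) < dist (ext f t) (ext f' t) / 2" using nat_approx_posE by blast
      obtain q where q: "q \<in> D" "dist (ext f t) q < 1 / real (Suc n)"
        using D(2)[of "1 / real (Suc n)" "ext f t"] inS[OF f(1)] by auto
      then have "(t, q, n) \<in> code f" using t by (simp add: code_def C_def)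
      then have "dist (ext f' t) q < 1 / real (Suc n)" unfolding ceq by (simp add: code_def)
      then show False using q(2) n dist_triangle2[of "ext f t" "ext f' t" q] by linarith
    qed
    then have "\<rat> \<subseteq> {t. ext f t = ext f' t}" by blast
    moreover have "closed {t. ext f t = ext f' t}"
      by (intro closed_Collect_eq cont f)
    ultimately have "closure \<rat> \<subseteq> {t. ext f t = ext f' t}" by (rule closure_minimal)
    then have all: "ext f t = ext f' t" for t by (auto simp: Rats_closure_real)
    have "pth f t = pth f' t" if "t \<in> {0..1}" for t
      using all[of t] that by (simp add: ext_def max_def min_def split: if_splits)
    then have "path_simplex (pth f) = path_simplex (pth f')" by (simp add: path_simplex_eq_iff)
    then show "f = f'" using pth[OF f(1)] pth[OF f(2)] by simp
  qed
  then show ?thesis unfolding lepoll_def by blast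
qed

text \<open>Below, the inequivalent loops have distinct images. Above, every class comes from a
  cycle, a finite integral combination of at most continuum many paths.\<close>

lemma not_small_loops_torsion_imp_continuum:
  fixes S :: "'a::real_normed_vector set"
  assumes S: "compact S" "locally_path_connected_space (top_of_set S)"
    and nt: "\<And>e. 0 < e \<Longrightarrow> \<not> small_loops_torsion S e"
  shows "carrier (tf (homology_group 1 (top_of_set S))) \<approx> (UNIV :: real set)"
proof -
  let ?X = "top_of_set S" let ?T = "tf (homology_group 1 ?X)"
  interpret H: comm_group "homology_group 1 ?X" by (rule abelian_homology_group)
  interpret T: comm_group ?T by (rule H.comm_group_tf)
  obtain \<theta> where \<theta>: "\<theta> ` singular_relcycle_set 1 ?X {} = carrier ?T"
    "\<And>c. singular_relcycle 1 ?X {} c \<Longrightarrow> \<theta> c = \<one>\<^bsub>?T\<^esub> \<longleftrightarrow> torsion_boundary ?X c"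
    and \<theta>diff: "\<And>a b. singular_relcycle 1 ?X {} a \<Longrightarrow> singular_relcycle 1 ?X {} b \<Longrightarrow>
      \<theta> (a - b) = \<theta> a \<otimes>\<^bsub>?T\<^esub> inv\<^bsub>?T\<^esub> \<theta> b"
    by (rule cycle_to_tf_homology[of ?X]) (rule that)
  obtain x and V :: "(nat \<Rightarrow> bool) \<Rightarrow> real \<Rightarrow> 'a" where V: "\<And>\<alpha>. connects S x x (V \<alpha>)"
    and Vne: "\<And>\<alpha> \<beta>. \<alpha> \<noteq> \<beta> \<Longrightarrow> \<not> torsion_boundary ?X (path_chain (V \<alpha>) - path_chain (V \<beta>))"
    using continuum_many_nonhomologous_loops[OF S nt] by blast
  have cyc: "singular_relcycle 1 ?X {} (path_chain (V \<alpha>))" for \<alpha>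
    using V[of \<alpha>] by (intro singular_relcycle_loop) (auto simp: connects_def)
  have \<theta>in: "\<theta> c \<in> carrier ?T" if "singular_relcycle 1 ?X {} c" for c
    using that \<theta>(1) by blast
  have "inj (\<lambda>A. \<theta> (path_chain (V (\<lambda>n. n \<in> A))))"
  proof (rule injI, rule ccontr)
    fix A B :: "nat set" assume eq: "\<theta> (path_chain (V (\<lambda>n. n \<in> A))) = \<theta> (path_chain (V (\<lambda>n. n \<in> B)))" and "A \<noteq> B"
    then have "(\<lambda>n. n \<in> A) \<noteq> (\<lambda>n. n \<in> B)" by (metis Collect_mem_eq)
    moreover have "\<theta> (path_chain (V (\<lambda>n. n \<in> A)) - path_chain (V (\<lambda>n. n \<in> B))) = \<one>\<^bsub>?T\<^esub>"
      unfolding \<theta>diff[OF cyc cyc] eq using T.r_inv \<theta>in[OF cyc] by blast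
    ultimately show False using Vne \<theta>(2)[OF singular_relcycle_diff[OF cyc cyc]] by blast
  qed
  then have low: "(UNIV :: nat set set) \<lesssim> carrier ?T"
    unfolding lepoll_def using \<theta>in[OF cyc] by blast
  \<comment> \<open>A free abelian group is equipotent to its basis when the basis is infinite; the
    loops already found show that it is.\<close>
  have "inj (\<lambda>\<alpha>. path_simplex (V \<alpha>))"
  proof (rule injI, rule ccontr)
    fix \<alpha> \<beta> assume "path_simplex (V \<alpha>) = path_simplex (V \<beta>)" "\<alpha> \<noteq> \<beta>"
    then show False using Vne[of \<alpha> \<beta>] torsion_boundary_0[of ?X] by simp
  qed
  moreover have "range (\<lambda>\<alpha>. path_simplex (V \<alpha>)) \<subseteq> singular_simplex_set 1 ?X"
    using V by (intro image_subsetI CollectI singular_simplex_path_simplex) (auto simp: connects_def)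
  moreover have "infinite (UNIV :: (nat \<Rightarrow> bool) set)" by (simp add: finite_UNIV_fun)
  ultimately have inf: "infinite (singular_simplex_set 1 ?X)"
    by (meson finite_imageD finite_subset)
  have "carrier ?T \<lesssim> singular_relcycle_set 1 ?X {}" unfolding \<theta>(1)[symmetric] by (rule image_lepoll)
  also have "\<dots> \<lesssim> carrier (free_Abelian_group (singular_simplex_set 1 ?X))"
    by (rule subset_imp_lepoll) (auto simp: singular_cycle singular_chain_def)
  also have "\<dots> \<approx> singular_simplex_set 1 ?X" by (rule eqpoll_free_Abelian_group_infinite[OF inf])
  also have "\<dots> \<lesssim> (UNIV :: nat set set)" by (rule path_simplices_lepoll[OF S(1)])
  finally show ?thesis using low nat_sets_eqpoll_reals by (meson lepoll_antisym eqpoll_trans)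
qed

text \<open>The Kuratowski embedding sends \<open>x\<close> to \<open>d x - d a\<close>, where subtracting \<open>d a\<close> for a fixed point
  \<open>a\<close> makes the function bounded; the discrete topology makes it continuous.\<close>

lemma compact_metrizable_homeomorphic_subset:
  fixes X :: "'a topology"
  assumes "compact_space X" "metrizable_space X"
  obtains S :: "('a discrete \<Rightarrow>\<^sub>C real) set" where "compact S" "X homeomorphic_space top_of_set S"
proof -
  obtain M d where Md: "Metric_space M d" and X: "X = Metric_space.mtopology M d"
    using assms(2) unfolding metrizable_space_def by blast
  interpret Metric_space M d by fact
  define a where "a = (SOME a. a \<in> M)"
  have a: "a \<in> M" if "x \<in> M" for x unfolding a_def using that by (metis someI)
  define k where "k x y = (if of_discrete y \<in> M then d x (of_discrete y) - d a (of_discrete y) else 0)" for x y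
  have kb: "k x \<in> bcontfun" if x: "x \<in> M" for x
  proof (rule bcontfun_normI)
    show "continuous_on UNIV (k x)"
      by (simp add: continuous_on_open_vimage open_discrete)
    fix y show "norm (k x y) \<le> d x a"
      using triangle[of x a "of_discrete y"] triangle[of a x "of_discrete y"] x a[OF x] commute[of x a]
      by (auto simp: k_def)
  qed
  define \<phi> where "\<phi> x = Bcontfun (k x)" for x
  have \<phi>: "apply_bcontfun (\<phi> x) = k x" if "x \<in> M" for x
    unfolding \<phi>_def using kb[OF that] by (simp add: Bcontfun_inverse)
  have dist_le: "dist (\<phi> x) (\<phi> y) \<le> d x y" if "x \<in> M" "y \<in> M" for x y
  proof (rule dist_bound)
    fix w show "dist (\<phi> x w) (\<phi> y w) \<le> d x y"
      using triangle[of x y "of_discrete w"] triangle[of y x "of_discrete w"] that commute[of x y] nonneg[of x y]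
      by (auto simp: \<phi> k_def dist_real_def)
  qed
  have inj: "inj_on \<phi> M"
  proof (rule inj_onI)
    fix x y assume xy: "x \<in> M" "y \<in> M" "\<phi> x = \<phi> y"
    \<comment> \<open>Evaluation at \<open>y\<close> itself recovers \<open>d x y\<close>, the terms
      with \<open>a\<close> cancelling.\<close>
    then have "k x (discrete y) = k y (discrete y)" using \<phi> by metis
    then have "d x y = 0" using xy by (simp add: k_def discrete_inverse)
    then show "x = y" using xy zero by simp
  qed
  have "continuous_map X (top_of_set (\<phi> ` M)) \<phi>"
  proof -
    have "openin mtopology {x \<in> M. \<phi> x \<in> U}" if "open U" for U
      unfolding openin_mtopology
    proof (intro conjI allI impI)
      fix x assume x: "x \<in> {x \<in> M. \<phi> x \<in> U}"
      then obtain e where e: "e > 0" "ball (\<phi> x) e \<subseteq> U" using \<open>open U\<close> open_contains_ball by blast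
      have "mball x e \<subseteq> {x \<in> M. \<phi> x \<in> U}"
      proof
        fix y assume "y \<in> mball x e"
        then have y: "y \<in> M" "d x y < e" by auto
        then have "\<phi> y \<in> ball (\<phi> x) e" using dist_le[of x y] x by simp
        then show "y \<in> {x \<in> M. \<phi> x \<in> U}" using e y by auto
      qed
      then show "\<exists>r>0. mball x r \<subseteq> {x \<in> M. \<phi> x \<in> U}" using e(1) by blast
    qed auto
    then show ?thesis unfolding X by (auto simp: continuous_map_in_subtopology) (simp add: continuous_map)
  qed
  then have "homeomorphic_map X (top_of_set (\<phi> ` M)) \<phi>"
    by (rule continuous_imp_homeomorphic_map)
      (use assms(1) inj in \<open>auto simp: X Hausdorff_space_subtopology\<close>)
  then have h: "X homeomorphic_space top_of_set (\<phi> ` M)"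
    using homeomorphic_map_imp_homeomorphic_space by blast
  then have "compact_space (top_of_set (\<phi> ` M))" using assms(1) homeomorphic_compact_space by blast
  then have "compact (\<phi> ` M)" by (metis compactin_subspace compactin_euclidean_iff subset_UNIV topspace_euclidean)
  then show ?thesis using that h by blast
qed

theorem theorem3p4:
  fixes X :: "'a topology"
  assumes "peano_continuum X"
  shows "(\<exists>S :: nat set. finite S \<and> tf (homology_group 1 X) \<cong> free_Abelian_group S)
         \<or> carrier (tf (homology_group 1 X)) \<approx> (UNIV :: real set)"
proof -
  have X: "path_connected_space X" "locally_path_connected_space X" "compact_space X" "metrizable_space X"
    using assms by (auto simp: peano_continuum_def)
  obtain S :: "('a discrete \<Rightarrow>\<^sub>C real) set" where S: "compact S" and h: "X homeomorphic_space top_of_set S"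
    using compact_metrizable_homeomorphic_subset[OF X(3,4)] by blast
  have pc: "path_connected_space (top_of_set S)" "locally_path_connected_space (top_of_set S)"
    using X h homeomorphic_path_connected_space homeomorphic_locally_path_connected_space by blast+
  have iso: "tf (homology_group 1 X) \<cong> tf (homology_group 1 (top_of_set S))"
    by (intro tf_iso_cong abelian_homology_group homeomorphic_space_imp_isomorphic_homology_groups h)
  show ?thesis
  proof (cases "\<exists>e>0. small_loops_torsion S e")
    case True
    then obtain T :: "nat set" where "finite T" "tf (homology_group 1 (top_of_set S)) \<cong> free_Abelian_group T"
      using small_loops_torsion_imp_free[OF S pc] by blast
    then show ?thesis using iso iso_trans by blast
  next
    case False
    then have "carrier (tf (homology_group 1 (top_of_set S))) \<approx> (UNIV :: real set)"
      by (intro not_small_loops_torsion_imp_continuum[OF S pc(2)]) blast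
    then show ?thesis using iso_imp_eqpoll_carrier[OF iso] eqpoll_trans by blast
  qed
qed

end
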